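(* Let $X$ be a simplicial set, let $\mathrm{R}$ be the simplicial real line, and let $h\colon X\rightarrow \mathrm{R}$ be a height function (i.e. a simplicial map). Then the diagonal of the section complex $\mathcal{S}_h$, which is a bisimplicial set, is homotopy equivalent to $X$: \[ \operatorname{diag}\mathcal{S}_h\simeq X . \]
   Context: Simplicial real line: $\mathrm{R}=\mathrm{N}(\mathbb{R},\leq)$, the nerve of the poset $(\mathbb{R},\le)$; an $n$-simplex is a non-decreasing sequence $\bar a=(a_0,\dots,a_n)$ of real numbers, equivalently a simplicial map $\bar a\colon\Delta^n\to \mathrm{R}$. A height function on a simplicial set $X$ is a simplicial map $h\colon X\to \mathrm{R}$. Section complex: for $\bar a\in \mathrm{R}_p$, let $\mathcal{S}_h[\bar a]$ be the pullback of $\Delta^0\xrightarrow{\bar a}\operatorname{map}(\Delta^p,\mathrm{R})\xleftarrow{h_*}\operatorname{map}(\Delta^p,X)$, where $\operatorname{map}$ is the simplicial mapping space. Thus its $q$-simplices are the simplicial maps $\rho\colon\Delta^p\times\Delta^q\to X$ with $h\circ\rho=\bar a\circ \mathrm{pr}_0$, where $\mathrm{pr}_0\colon\Delta^p\times\Delta^q\to\Delta^p$ is the projection. Put $(\mathcal{S}_h)_p=\coprod_{\bar a\in \mathrm{R}_p}\mathcal{S}_h[\bar a]$. The section complex $\mathcal{S}_h$ is the bisimplicial set with $(p,q)$-simplices $(\mathcal{S}_h)_{p,q}$ (the $q$-simplices of $(\mathcal{S}_h)_p$). Its horizontal face and degeneracy maps are given by precomposing $\rho$ with $\delta^i\times\mathrm{id}$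 and $\sigma^j\times\mathrm{id}$, and its vertical ones by precomposing with $\mathrm{id}\times\delta^i$ and $\mathrm{id}\times\sigma^j$, where $\delta^i,\sigma^j$ are the coface and codegeneracy maps between standard simplices. The diagonal $\operatorname{diag}\mathcal{S}_h$ is the simplicial set with $n$-simplices $(\mathcal{S}_h)_{n,n}$ and structure maps $d_i=d_i^hd_i^v$, $s_j=s_j^hs_j^v$. Homotopy equivalence: simplicial maps in both directions which are mutually inverse up to simplicial homotopy, where a simplicial homotopy is a simplicial map $Y\times I\to Z$ with $I$ a simplicial set whose geometric realization is the unit interval. *)

theory Defs
  imports "HOL-Homology.Simplices" "HOL-Analysis.Sum_Topology" "HOL-Library.FuncSet"
begin

section \<open>Simplicial sets\<close>

text \<open>
  The monotone maps \<open>[m] \<rightarrow> [n]\<close> of the simplex category are represented by their lists of values.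
  The composite of \<open>\<theta>\<close> after \<open>\<phi>\<close> is \<open>map ((!) \<theta>) \<phi>\<close>, and the identity of \<open>[n]\<close> is \<open>[0..<Suc n]\<close>.
\<close>

definition monotone_maps :: "nat \<Rightarrow> nat \<Rightarrow> nat list set" where
  "monotone_maps m n = {\<theta>. length \<theta> = Suc m \<and> sorted \<theta> \<and> set \<theta> \<subseteq> {..n}}"

text \<open>
  \<open>act X n \<theta>\<close> is the structure map \<open>X\<^sub>n \<rightarrow> X\<^sub>m\<close> of \<open>\<theta> : [m] \<rightarrow> [n]\<close>. The target dimension
  can be read off from the length of \<open>\<theta>\<close>, the source dimension cannot. Faces and degeneracies are
  the actions of the cofaces and codegeneracies.
\<close>

record 'a sset =
  simps :: "nat \<Rightarrow> 'a set"
  act :: "nat \<Rightarrow> nat list \<Rightarrow> 'a \<Rightarrow> 'a"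

definition simplicial_set :: "'a sset \<Rightarrow> bool" where
  "simplicial_set X \<longleftrightarrow>
     (\<forall>m n. \<forall>\<theta>\<in>monotone_maps m n. \<forall>x\<in>simps X n. act X n \<theta> x \<in> simps X m) \<and>
     (\<forall>n. \<forall>x\<in>simps X n. act X n [0..<Suc n] x = x) \<and>
     (\<forall>l m n. \<forall>\<phi>\<in>monotone_maps l m. \<forall>\<theta>\<in>monotone_maps m n. \<forall>x\<in>simps X n.
        act X m \<phi> (act X n \<theta> x) = act X n (map ((!) \<theta>) \<phi>) x)"

text \<open>
  Simplicial maps are taken to be undefined outside the simplices of their source, so that two of
  them are equal as HOL functions if and only if they agree on all simplices.
\<close>

definition simplicial_maps :: "'a sset \<Rightarrow> 'b sset \<Rightarrow> (nat \<Rightarrow> 'a \<Rightarrow> 'b) set" where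
  "simplicial_maps X Y = {f.
     (\<forall>n. f n \<in> simps X n \<rightarrow>\<^sub>E simps Y n) \<and>
     (\<forall>m n. \<forall>\<theta>\<in>monotone_maps m n. \<forall>x\<in>simps X n. f m (act X n \<theta> x) = act Y n \<theta> (f n x))}"

definition sid :: "'a sset \<Rightarrow> nat \<Rightarrow> 'a \<Rightarrow> 'a" where
  "sid X n = restrict id (simps X n)"

definition scomp :: "'a sset \<Rightarrow> (nat \<Rightarrow> 'b \<Rightarrow> 'c) \<Rightarrow> (nat \<Rightarrow> 'a \<Rightarrow> 'b) \<Rightarrow> nat \<Rightarrow> 'a \<Rightarrow> 'c" where
  "scomp X g f n = compose (simps X n) (g n) (f n)"

definition sprod :: "'a sset \<Rightarrow> 'b sset \<Rightarrow> ('a \<times> 'b) sset" where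
  "sprod X Y = \<lparr>simps = (\<lambda>n. simps X n \<times> simps Y n),
                act = (\<lambda>n \<theta>. map_prod (act X n \<theta>) (act Y n \<theta>))\<rparr>"

definition sfst :: "'a sset \<Rightarrow> 'b sset \<Rightarrow> nat \<Rightarrow> 'a \<times> 'b \<Rightarrow> 'a" where
  "sfst X Y n = restrict fst (simps (sprod X Y) n)"

text \<open>\<open>smap_prod X Y f g\<close> is the map \<open>f \<times> g\<close> with source \<open>X \<times> Y\<close>.\<close>

definition smap_prod ::
    "'a sset \<Rightarrow> 'b sset \<Rightarrow> (nat \<Rightarrow> 'a \<Rightarrow> 'c) \<Rightarrow> (nat \<Rightarrow> 'b \<Rightarrow> 'd) \<Rightarrow> nat \<Rightarrow> 'a \<times> 'b \<Rightarrow> 'c \<times> 'd" where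
  "smap_prod X Y f g n = restrict (map_prod (f n) (g n)) (simps (sprod X Y) n)"

definition nerve :: "'a::order set \<Rightarrow> 'a list sset" where
  "nerve P = \<lparr>simps = (\<lambda>n. {xs. length xs = Suc n \<and> sorted_wrt (\<le>) xs \<and> set xs \<subseteq> P}),
              act = (\<lambda>n \<theta> xs. map ((!) xs) \<theta>)\<rparr>"

definition std_simplex :: "nat \<Rightarrow> nat list sset" where
  "std_simplex n = nerve {..n}"

definition real_line :: "real list sset" where
  "real_line = nerve UNIV"

text \<open>
  The simplicial map \<open>\<Delta>\<^sup>p \<rightarrow> X\<close> corresponding to a \<open>p\<close>-simplex \<open>x\<close>. An operator
  \<open>\<theta> : [m] \<rightarrow> [p]\<close> is an \<open>m\<close>-simplex of \<open>\<Delta>\<^sup>p\<close>, and so induces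
  \<open>simplex_map (std_simplex p) m \<theta> : \<Delta>\<^sup>m \<rightarrow> \<Delta>\<^sup>p\<close>.
\<close>

definition simplex_map :: "'a sset \<Rightarrow> nat \<Rightarrow> 'a \<Rightarrow> nat \<Rightarrow> nat list \<Rightarrow> 'a" where
  "simplex_map X p x n = restrict (\<lambda>\<theta>. act X p \<theta> x) (simps (std_simplex p) n)"

section \<open>Bisimplicial sets\<close>

text \<open>
  \<open>hact B p q \<theta>\<close> and \<open>vact B p q \<theta>\<close> act on the \<open>(p, q)\<close>-simplices, \<open>\<theta>\<close> being a monotone map into
  \<open>[p]\<close> and into \<open>[q]\<close>, respectively.
\<close>

record 'a bisset =
  bisimps :: "nat \<Rightarrow> nat \<Rightarrow> 'a set"
  hact :: "nat \<Rightarrow> nat \<Rightarrow> nat list \<Rightarrow> 'a \<Rightarrow> 'a"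
  vact :: "nat \<Rightarrow> nat \<Rightarrow> nat list \<Rightarrow> 'a \<Rightarrow> 'a"

definition bisimplicial_set :: "'a bisset \<Rightarrow> bool" where
  "bisimplicial_set B \<longleftrightarrow>
     (\<forall>q. simplicial_set \<lparr>simps = (\<lambda>p. bisimps B p q), act = (\<lambda>p. hact B p q)\<rparr>) \<and>
     (\<forall>p. simplicial_set \<lparr>simps = (\<lambda>q. bisimps B p q), act = (\<lambda>q. vact B p q)\<rparr>) \<and>
     (\<forall>m p n q. \<forall>\<theta>\<in>monotone_maps m p. \<forall>\<phi>\<in>monotone_maps n q. \<forall>x\<in>bisimps B p q.
        hact B p n \<theta> (vact B p q \<phi> x) = vact B m q \<phi> (hact B p q \<theta> x))"

definition diag :: "'a bisset \<Rightarrow> 'a sset" where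
  "diag B = \<lparr>simps = (\<lambda>n. bisimps B n n),
             act = (\<lambda>n \<theta> x. hact B n (length \<theta> - 1) \<theta> (vact B n n \<theta> x))\<rparr>"

section \<open>The section complex\<close>

text \<open>\<open>sections X h p a q\<close> is the set of \<open>q\<close>-simplices of \<open>\<S>\<^sub>h[a]\<close>, for a \<open>p\<close>-simplex \<open>a\<close> of the
  real line.\<close>

definition sections :: "'a sset \<Rightarrow> (nat \<Rightarrow> 'a \<Rightarrow> real list) \<Rightarrow> nat \<Rightarrow> real list \<Rightarrow> nat \<Rightarrow>
    (nat \<Rightarrow> nat list \<times> nat list \<Rightarrow> 'a) set" where
  "sections X h p a q =
     {\<rho> \<in> simplicial_maps (sprod (std_simplex p) (std_simplex q)) X.
        scomp (sprod (std_simplex p) (std_simplex q)) h \<rho> =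
        scomp (sprod (std_simplex p) (std_simplex q))
          (simplex_map real_line p a) (sfst (std_simplex p) (std_simplex q))}"

text \<open>An element \<open>(a, \<rho>)\<close> of the coproduct is the simplex \<open>\<rho>\<close> in the summand \<open>\<S>\<^sub>h[a]\<close>.\<close>

definition section_complex ::
    "'a sset \<Rightarrow> (nat \<Rightarrow> 'a \<Rightarrow> real list) \<Rightarrow>
     (real list \<times> (nat \<Rightarrow> nat list \<times> nat list \<Rightarrow> 'a)) bisset" where
  "section_complex X h =
     \<lparr>bisimps = (\<lambda>p q. SIGMA a : simps real_line p. sections X h p a q),
      hact = (\<lambda>p q \<theta> (a, \<rho>).
        let m = length \<theta> - 1 in
        (act real_line p \<theta> a,
         scomp (sprod (std_simplex m) (std_simplex q)) \<rho>
           (smap_prod (std_simplex m) (std_simplex q)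
              (simplex_map (std_simplex p) m \<theta>) (sid (std_simplex q))))),
      vact = (\<lambda>p q \<theta> (a, \<rho>).
        let m = length \<theta> - 1 in
        (a,
         scomp (sprod (std_simplex p) (std_simplex m)) \<rho>
           (smap_prod (std_simplex p) (std_simplex m)
              (sid (std_simplex p)) (simplex_map (std_simplex q) m \<theta>))))\<rparr>"

section \<open>Geometric realization\<close>

definition quotient_topology :: "'a topology \<Rightarrow> 'a rel \<Rightarrow> 'a set topology" where
  "quotient_topology T R =
     topology (\<lambda>U. U \<subseteq> topspace T // R \<and> openin T {x \<in> topspace T. R `` {x} \<in> U})"

text \<open>The affine map of topological simplices that takes vertex \<open>i\<close> to vertex \<open>\<theta>(i)\<close>.\<close>

definition simplex_push :: "nat list \<Rightarrow> (nat \<Rightarrow> real) \<Rightarrow> nat \<Rightarrow> real" where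
  "simplex_push \<theta> t j = (\<Sum>i | i < length \<theta> \<and> \<theta> ! i = j. t i)"

text \<open>
  The geometric realization is the quotient of the coproduct of the spaces \<open>X\<^sub>n \<times> |\<Delta>\<^sup>n|\<close>, with
  \<open>X\<^sub>n\<close> discrete, by the equivalence relation generated by \<open>(x\<theta>, t) \<sim> (x, \<theta>\<^sub>*t)\<close>. The
  point \<open>t\<close> in the copy of \<open>|\<Delta>\<^sup>n|\<close> that belongs to the \<open>n\<close>-simplex \<open>x\<close> is written \<open>((n, x), t)\<close>.
\<close>

definition simplex_coproduct :: "'a sset \<Rightarrow> ((nat \<times> 'a) \<times> (nat \<Rightarrow> real)) topology" where
  "simplex_coproduct X =
     sum_topology (\<lambda>(n, x). subtopology (powertop_real UNIV) (standard_simplex n))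
       (SIGMA n : UNIV. simps X n)"

inductive realization_step ::
    "'a sset \<Rightarrow> (nat \<times> 'a) \<times> (nat \<Rightarrow> real) \<Rightarrow> (nat \<times> 'a) \<times> (nat \<Rightarrow> real) \<Rightarrow> bool"
  for X where
  "\<theta> \<in> monotone_maps m n \<Longrightarrow> x \<in> simps X n \<Longrightarrow> t \<in> standard_simplex m \<Longrightarrow>
     realization_step X ((m, act X n \<theta> x), t) ((n, x), simplex_push \<theta> t)"

definition realization_rel :: "'a sset \<Rightarrow> ((nat \<times> 'a) \<times> (nat \<Rightarrow> real)) rel" where
  "realization_rel X = {(u, v). equivclp (realization_step X) u v}"

definition realization :: "'a sset \<Rightarrow> ((nat \<times> 'a) \<times> (nat \<Rightarrow> real)) set topology" where
  "realization X = quotient_topology (simplex_coproduct X) (realization_rel X)"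

definition vertex_point :: "'a sset \<Rightarrow> 'a \<Rightarrow> ((nat \<times> 'a) \<times> (nat \<Rightarrow> real)) set" where
  "vertex_point X v = realization_rel X `` {((0, v), \<lambda>j. if j = 0 then 1 else 0)}"

section \<open>Homotopy equivalence\<close>

definition simplicial_interval :: "'a sset \<Rightarrow> 'a \<Rightarrow> 'a \<Rightarrow> bool" where
  "simplicial_interval I e0 e1 \<longleftrightarrow> simplicial_set I \<and> e0 \<in> simps I 0 \<and> e1 \<in> simps I 0 \<and>
     (\<exists>\<phi>. homeomorphic_map (realization I) (top_of_set {0..1::real}) \<phi> \<and>
        \<phi> (vertex_point I e0) = 0 \<and> \<phi> (vertex_point I e1) = 1)"

text \<open>
  HOL cannot quantify over the type carrying the interval. Fixing it to be \<open>nat list\<close> loses no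
  generality: the realization being compact, the interval has only finitely many
  nondegenerate simplices, so it has countably many simplices and is isomorphic to a simplicial set
  on any given infinite type. The vertex \<open>e\<close> is constant in degree \<open>n\<close> at
  \<open>act I 0 (replicate (Suc n) 0) e\<close>.
\<close>

definition shomotopic ::
    "'a sset \<Rightarrow> 'b sset \<Rightarrow> (nat \<Rightarrow> 'a \<Rightarrow> 'b) \<Rightarrow> (nat \<Rightarrow> 'a \<Rightarrow> 'b) \<Rightarrow> bool" where
  "shomotopic Y Z f g \<longleftrightarrow>
     (\<exists>(I :: nat list sset) e0 e1 H.
        simplicial_interval I e0 e1 \<and> H \<in> simplicial_maps (sprod Y I) Z \<and>
        (\<forall>n. \<forall>y\<in>simps Y n.
           H n (y, act I 0 (replicate (Suc n) 0) e0) = f n y \<and>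
           H n (y, act I 0 (replicate (Suc n) 0) e1) = g n y))"

definition shomotopy_equivalent :: "'a sset \<Rightarrow> 'b sset \<Rightarrow> bool"  (infix "\<simeq>\<^sub>s" 50) where
  "Y \<simeq>\<^sub>s Z \<longleftrightarrow>
     (\<exists>f\<in>simplicial_maps Y Z. \<exists>g\<in>simplicial_maps Z Y.
        shomotopic Y Y (scomp Y g f) (sid Y) \<and> shomotopic Z Z (scomp Z f g) (sid Z))"

section \<open>The section complex is a bisimplicial set\<close>

lemma monotone_maps_comp:
  assumes "\<theta> \<in> monotone_maps m n" "\<phi> \<in> monotone_maps l m"
  shows "map ((!) \<theta>) \<phi> \<in> monotone_maps l n"
  using assms
  by (fastforce simp: monotone_maps_def sorted_iff_nth_mono subset_eq all_set_conv_all_nth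
      less_Suc_eq_le)

lemma monotone_maps_id: "[0..<Suc n] \<in> monotone_maps n n"
  by (auto simp: monotone_maps_def simp del: upt_Suc)

lemma simps_std_simplex: "simps (std_simplex n) m = monotone_maps m n"
  by (simp add: std_simplex_def nerve_def monotone_maps_def)

lemma act_std_simplex: "act (std_simplex n) m \<theta> \<phi> = map ((!) \<phi>) \<theta>"
  by (simp add: std_simplex_def nerve_def)

lemma map_nth_assoc:
  assumes "\<theta> \<in> monotone_maps m n" "\<phi> \<in> monotone_maps l m" 
  shows "map ((!) (map ((!) xs) \<theta>)) \<phi> = map ((!) xs) (map ((!) \<theta>) \<phi>)"
  using assms by (fastforce simp: monotone_maps_def subset_eq)

lemma simplicial_set_nerve: "simplicial_set (nerve P)"
proof -
  have closed: "map ((!) xs) \<theta> \<in> simps (nerve P) m"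
    if "\<theta> \<in> monotone_maps m n" "xs \<in> simps (nerve P) n" for m n \<theta> xs
  proof -
    have \<theta>: "length \<theta> = Suc m" "sorted \<theta>" "set \<theta> \<subseteq> {..n}"
      and xs: "length xs = Suc n" "sorted_wrt (\<le>) xs" "set xs \<subseteq> P"
      using that by (auto simp: nerve_def monotone_maps_def)
    have mono: "xs ! i \<le> xs ! j" if "i \<in> set \<theta>" "j \<in> set \<theta>" "i \<le> j" for i j
      using xs \<theta>(3) that by (cases "i = j") (auto simp: sorted_wrt_iff_nth_less subset_eq)
    have "sorted_wrt (\<lambda>i j. xs ! i \<le> xs ! j) \<theta>"
      by (rule sorted_wrt_mono_rel[OF _ \<theta>(2)]) (rule mono)
    moreover have "xs ! i \<in> P" if "i \<in> set \<theta>" for i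
      using xs \<theta>(3) that nth_mem[of i xs] by (auto simp: subset_eq less_Suc_eq_le)
    ultimately show ?thesis
      using \<theta> by (auto simp: nerve_def sorted_wrt_map)
  qed
  have unit: "map ((!) xs) [0..<Suc n] = xs" if "xs \<in> simps (nerve P) n" for xs n
    using that map_nth[of xs] by (simp add: nerve_def del: upt_Suc)
  have act: "act (nerve P) n \<theta> xs = map ((!) xs) \<theta>" for n \<theta> xs
    by (simp add: nerve_def)
  show ?thesis
    unfolding simplicial_set_def act
    by (intro conjI allI ballI; (rule closed unit map_nth_assoc; assumption))
qed

lemma simplicial_set_std_simplex: "simplicial_set (std_simplex n)"
  by (simp add: std_simplex_def simplicial_set_nerve)

lemma simplicial_set_real_line: "simplicial_set real_line"
  by (simp add: real_line_def simplicial_set_nerve)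

lemma simplicial_set_sprod:
  assumes "simplicial_set X" "simplicial_set Y" shows "simplicial_set (sprod X Y)"
  using assms unfolding simplicial_set_def sprod_def by (auto simp del: upt_Suc) 

lemma scomp_simplicial:
  assumes "simplicial_set X" "f \<in> simplicial_maps X Y" "g \<in> simplicial_maps Y Z"
  shows "scomp X g f \<in> simplicial_maps X Z"
proof -
  have fY: "f n x \<in> simps Y n" if "x \<in> simps X n" for n x
    using assms(2) that by (auto simp: simplicial_maps_def)
  have gZ: "g n x \<in> simps Z n" if "x \<in> simps Y n" for n x
    using assms(3) that by (auto simp: simplicial_maps_def)
  show ?thesis
    using assms fY gZ unfolding simplicial_maps_def scomp_def
    by (auto simp: compose_def simplicial_set_def)
qed

lemma simplex_map_simplicial:
  assumes "simplicial_set X" "x \<in> simps X p"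
  shows "simplex_map X p x \<in> simplicial_maps (std_simplex p) X"
  using assms monotone_maps_comp
  unfolding simplicial_maps_def simplex_map_def simps_std_simplex act_std_simplex simplicial_set_def
  by (auto simp del: upt_Suc)

lemma sid_simplicial:
  assumes "simplicial_set X" shows "sid X \<in> simplicial_maps X X"
  using assms unfolding simplicial_maps_def sid_def simplicial_set_def by auto

lemma sfst_simplicial:
  assumes "simplicial_set X" "simplicial_set Y" shows "sfst X Y \<in> simplicial_maps (sprod X Y) X"
  using assms unfolding simplicial_maps_def sfst_def simplicial_set_def sprod_def by auto

lemma smap_prod_simplicial:
  assumes "simplicial_set X" "simplicial_set Y" "f \<in> simplicial_maps X X'" "g \<in> simplicial_maps Y Y'"
  shows "smap_prod X Y f g \<in> simplicial_maps (sprod X Y) (sprod X' Y')"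
  using assms unfolding simplicial_maps_def smap_prod_def simplicial_set_def sprod_def 
  by (fastforce simp: PiE_iff simp del: upt_Suc)

lemma monotone_maps_length: "\<theta> \<in> monotone_maps m n \<Longrightarrow> length \<theta> - 1 = m"
  by (simp add: monotone_maps_def)

lemma in_sections:
  "\<rho> \<in> sections X h p a q \<longleftrightarrow> \<rho> \<in> simplicial_maps (sprod (std_simplex p) (std_simplex q)) X \<and>
    (\<forall>n. \<forall>\<sigma>\<in>monotone_maps n p. \<forall>\<tau>\<in>monotone_maps n q. h n (\<rho> n (\<sigma>, \<tau>)) = act real_line p \<sigma> a)"
  by (auto simp: sections_def scomp_def sfst_def simplex_map_def compose_def sprod_def
      simps_std_simplex restrict_def fun_eq_iff)

lemma hact_eq:
  assumes "\<theta> \<in> monotone_maps m p"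
  shows "hact (section_complex X h) p q \<theta> (a, \<rho>) = (act real_line p \<theta> a,
     \<lambda>n. \<lambda>(\<sigma>, \<tau>)\<in>monotone_maps n m \<times> monotone_maps n q. \<rho> n (map ((!) \<theta>) \<sigma>, \<tau>))"
  using monotone_maps_length[OF assms]
  by (auto simp: section_complex_def Let_def scomp_def compose_def smap_prod_def
      sprod_def simps_std_simplex act_std_simplex sid_def simplex_map_def restrict_def fun_eq_iff)

lemma vact_eq:
  assumes "\<theta> \<in> monotone_maps m q"
  shows "vact (section_complex X h) p q \<theta> (a, \<rho>) = (a,
     \<lambda>n. \<lambda>(\<sigma>, \<tau>)\<in>monotone_maps n p \<times> monotone_maps n m. \<rho> n (\<sigma>, map ((!) \<theta>) \<tau>))"
  using monotone_maps_length[OF assms]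
  by (auto simp: section_complex_def Let_def scomp_def compose_def smap_prod_def
      sprod_def simps_std_simplex act_std_simplex sid_def simplex_map_def restrict_def fun_eq_iff)

lemma sections_restrict:
  assumes "\<rho> \<in> sections X h p a q" "\<theta> \<in> monotone_maps m p" "\<phi> \<in> monotone_maps k q"
    "a \<in> simps real_line p"
  shows "(\<lambda>n. \<lambda>(\<sigma>, \<tau>)\<in>monotone_maps n m \<times> monotone_maps n k. \<rho> n (map ((!) \<theta>) \<sigma>, map ((!) \<phi>) \<tau>))
    \<in> sections X h m (act real_line p \<theta> a) k"
proof -
  have 1: "act real_line m \<sigma> (act real_line p \<theta> a) = act real_line p (map ((!) \<theta>) \<sigma>) a"
    if "\<sigma> \<in> monotone_maps n m" for \<sigma> n
    using simplicial_set_real_line that assms unfolding simplicial_set_def by blast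
  have 2: "map ((!) \<theta>) \<sigma> \<in> monotone_maps n p" if "\<sigma> \<in> monotone_maps n m" for \<sigma> n
    using monotone_maps_comp that assms by blast
  have 3: "map ((!) \<phi>) \<sigma> \<in> monotone_maps n q" if "\<sigma> \<in> monotone_maps n k" for \<sigma> n
    using monotone_maps_comp that assms by blast
  have 4: "\<rho> n (\<sigma>, \<tau>) \<in> simps X n" if "\<sigma> \<in> monotone_maps n p" "\<tau> \<in> monotone_maps n q" for n \<sigma> \<tau>
    using assms(1) that by (auto simp: in_sections simplicial_maps_def sprod_def simps_std_simplex)
  have 5: "\<rho> j (map ((!) \<sigma>) \<psi>, map ((!) \<tau>) \<psi>) = act X n \<psi> (\<rho> n (\<sigma>, \<tau>))"
    if "\<psi> \<in> monotone_maps j n" "\<sigma> \<in> monotone_maps n p" "\<tau> \<in> monotone_maps n q" for n \<sigma> \<tau> j \<psi>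
    using assms(1) that
    by (fastforce simp: in_sections simplicial_maps_def sprod_def simps_std_simplex act_std_simplex)
  have 6: "h n (\<rho> n (\<sigma>, \<tau>)) = act real_line p \<sigma> a"
    if "\<sigma> \<in> monotone_maps n p" "\<tau> \<in> monotone_maps n q" for n \<sigma> \<tau>
    using assms(1) that by (auto simp: in_sections)
  have 7: "\<rho> j (map ((!) \<theta>) (map ((!) \<sigma>) \<psi>), map ((!) \<phi>) (map ((!) \<tau>) \<psi>)) =
      act X n \<psi> (\<rho> n (map ((!) \<theta>) \<sigma>, map ((!) \<phi>) \<tau>))"
    if "\<psi> \<in> monotone_maps j n" "\<sigma> \<in> monotone_maps n m" "\<tau> \<in> monotone_maps n k" for n \<sigma> \<tau> j \<psi>
    using 5[OF that(1) 2[OF that(2)] 3[OF that(3)]]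
    by (simp only: map_nth_assoc[OF that(2,1)] map_nth_assoc[OF that(3,1)])
  show ?thesis
    unfolding in_sections simplicial_maps_def
    using 1 2 3 4 6 7 monotone_maps_comp
    by (auto simp: sprod_def simps_std_simplex act_std_simplex simp del: map_map)
qed

lemma map_id_op: "\<sigma> \<in> monotone_maps n p \<Longrightarrow> map ((!) [0..<Suc p]) \<sigma> = \<sigma>"
  by (auto simp: monotone_maps_def subset_eq less_Suc_eq_le intro!: map_idI simp del: upt_Suc)

lemma restrict_cong2:
  assumes "\<And>x y. x \<in> A \<Longrightarrow> y \<in> B \<Longrightarrow> f x y = g x y"
  shows "(\<lambda>(x, y)\<in>A \<times> B. f x y) = (\<lambda>(x, y)\<in>A \<times> B. g x y)"
  using assms by (auto simp: restrict_def fun_eq_iff)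

lemma section_ext:
  assumes "\<rho> \<in> sections X h p a q" 
  shows "(\<lambda>n. \<lambda>(\<sigma>, \<tau>)\<in>monotone_maps n p \<times> monotone_maps n q. \<rho> n (\<sigma>, \<tau>)) = \<rho>"
proof
  fix n
  have "\<rho> n \<in> extensional (monotone_maps n p \<times> monotone_maps n q)"
    using assms by (auto simp: in_sections simplicial_maps_def sprod_def simps_std_simplex PiE_def)
  then show "(\<lambda>(\<sigma>, \<tau>)\<in>monotone_maps n p \<times> monotone_maps n q. \<rho> n (\<sigma>, \<tau>)) = \<rho> n"
    using extensional_restrict by fastforce
qed

lemma bisimps_section_complex:
  "bisimps (section_complex X h) p q = (SIGMA a : simps real_line p. sections X h p a q)"
  by (simp add: section_complex_def)

lemma hact_closed:
  assumes "\<theta> \<in> monotone_maps m p" "x \<in> bisimps (section_complex X h) p q"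
  shows "hact (section_complex X h) p q \<theta> x \<in> bisimps (section_complex X h) m q"
proof -
  obtain a \<rho> where x: "x = (a, \<rho>)" "a \<in> simps real_line p" "\<rho> \<in> sections X h p a q"
    using assms by (auto simp: bisimps_section_complex)
  have "act real_line p \<theta> a \<in> simps real_line m"
    using simplicial_set_real_line x assms unfolding simplicial_set_def by blast
  then show ?thesis
    using sections_restrict[OF x(3) assms(1) monotone_maps_id x(2)] x assms
    by (simp add: bisimps_section_complex hact_eq map_id_op cong: restrict_cong2 del: upt_Suc)
qed

lemma vact_closed:
  assumes "\<theta> \<in> monotone_maps m q" "x \<in> bisimps (section_complex X h) p q"
  shows "vact (section_complex X h) p q \<theta> x \<in> bisimps (section_complex X h) p m"
proof -
  obtain a \<rho> where x: "x = (a, \<rho>)" "a \<in> simps real_line p" "\<rho> \<in> sections X h p a q"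
    using assms by (auto simp: bisimps_section_complex)
  have "act real_line p [0..<Suc p] a = a"
    using simplicial_set_real_line x assms unfolding simplicial_set_def by blast
  then show ?thesis
    using sections_restrict[OF x(3) monotone_maps_id assms(1) x(2)] x assms
    by (simp add: bisimps_section_complex vact_eq map_id_op cong: restrict_cong2 del: upt_Suc)
qed

lemma bisimplicial_set_section_complex: "bisimplicial_set (section_complex X h)"
  unfolding bisimplicial_set_def
proof (intro conjI allI ballI)
  show "simplicial_set \<lparr>simps = \<lambda>p. bisimps (section_complex X h) p q,
      act = \<lambda>p. hact (section_complex X h) p q\<rparr>" for q
    unfolding simplicial_set_def sset.simps
  proof (intro conjI allI ballI)
    fix n x assume "x \<in> bisimps (section_complex X h) n q"
    then obtain a \<rho> where x: "x = (a, \<rho>)" "a \<in> simps real_line n" "\<rho> \<in> sections X h n a q"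
      by (auto simp: bisimps_section_complex)
    have "act real_line n [0..<Suc n] a = a"
      using simplicial_set_real_line x unfolding simplicial_set_def by blast
    then show "hact (section_complex X h) n q [0..<Suc n] x = x"
      using section_ext[OF x(3)]
      by (simp add: x(1) hact_eq[OF monotone_maps_id] map_id_op cong: restrict_cong2 del: upt_Suc)
  next
    fix l m n \<phi> \<theta> x assume *: "\<phi> \<in> monotone_maps l m" "\<theta> \<in> monotone_maps m n"
      "x \<in> bisimps (section_complex X h) n q"
    then obtain a \<rho> where x: "x = (a, \<rho>)" "a \<in> simps real_line n" "\<rho> \<in> sections X h n a q"
      by (auto simp: bisimps_section_complex)
    have "act real_line m \<phi> (act real_line n \<theta> a) = act real_line n (map ((!) \<theta>) \<phi>) a"
      using simplicial_set_real_line x * unfolding simplicial_set_def by blast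
    then show "hact (section_complex X h) m q \<phi> (hact (section_complex X h) n q \<theta> x) =
       hact (section_complex X h) n q (map ((!) \<theta>) \<phi>) x"
      unfolding x(1) hact_eq[OF *(1)] hact_eq[OF *(2)] hact_eq[OF monotone_maps_comp[OF *(2,1)]]
      by (auto simp: monotone_maps_comp[OF *(1)] map_nth_assoc[OF *(1)]
          intro!: restrict_cong2 simp del: map_map)
  qed (rule hact_closed)
next
  show "simplicial_set \<lparr>simps = \<lambda>q. bisimps (section_complex X h) p q,
      act = \<lambda>q. vact (section_complex X h) p q\<rparr>" for p
    unfolding simplicial_set_def sset.simps
  proof (intro conjI allI ballI)
    fix n x assume "x \<in> bisimps (section_complex X h) p n"
    then obtain a \<rho> where x: "x = (a, \<rho>)" "a \<in> simps real_line p" "\<rho> \<in> sections X h p a n"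
      by (auto simp: bisimps_section_complex)
    show "vact (section_complex X h) p n [0..<Suc n] x = x"
      using section_ext[OF x(3)]
      by (simp add: x(1) vact_eq[OF monotone_maps_id] map_id_op cong: restrict_cong2 del: upt_Suc)
  next
    fix l m n \<phi> \<theta> x assume *: "\<phi> \<in> monotone_maps l m" "\<theta> \<in> monotone_maps m n"
      "x \<in> bisimps (section_complex X h) p n"
    then obtain a \<rho> where x: "x = (a, \<rho>)" "a \<in> simps real_line p" "\<rho> \<in> sections X h p a n"
      by (auto simp: bisimps_section_complex)
    show "vact (section_complex X h) p m \<phi> (vact (section_complex X h) p n \<theta> x) =
       vact (section_complex X h) p n (map ((!) \<theta>) \<phi>) x"
      unfolding x(1) vact_eq[OF *(1)] vact_eq[OF *(2)] vact_eq[OF monotone_maps_comp[OF *(2,1)]]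
      by (auto simp: monotone_maps_comp[OF *(1)] map_nth_assoc[OF *(1)]
          intro!: restrict_cong2 simp del: map_map)
  qed (rule vact_closed)
next
  fix m p n q \<theta> \<phi> x
  assume *: "\<theta> \<in> monotone_maps m p" "\<phi> \<in> monotone_maps n q" "x \<in> bisimps (section_complex X h) p q"
  show "hact (section_complex X h) p n \<theta> (vact (section_complex X h) p q \<phi> x) =
       vact (section_complex X h) m q \<phi> (hact (section_complex X h) p q \<theta> x)"
    by (cases x) (auto simp: hact_eq[OF *(1)] vact_eq[OF *(2)] monotone_maps_comp[OF *(1)]
        monotone_maps_comp[OF *(2)] intro!: restrict_cong2)
qed

lemma simplicial_set_diag:
  assumes "bisimplicial_set B"
  shows "simplicial_set (diag B)"
proof -
  let ?H = "hact B" and ?V = "vact B" and ?B = "bisimps B"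
  have hc: "?H p q \<theta> x \<in> ?B m q" and hi: "?H p q [0..<Suc p] x = x"
    if "x \<in> ?B p q" "\<theta> \<in> monotone_maps m p" for m p q \<theta> x
    using assms that by (auto simp: bisimplicial_set_def simplicial_set_def simp del: upt_Suc)
  have vc: "?V p q \<theta> x \<in> ?B p m" and vi: "?V p q [0..<Suc q] x = x"
    if "x \<in> ?B p q" "\<theta> \<in> monotone_maps m q" for m p q \<theta> x
    using assms that by (auto simp: bisimplicial_set_def simplicial_set_def simp del: upt_Suc)
  have hh: "?H m q \<phi> (?H p q \<theta> x) = ?H p q (map ((!) \<theta>) \<phi>) x"
    if "\<phi> \<in> monotone_maps l m" "\<theta> \<in> monotone_maps m p" "x \<in> ?B p q" for l m p q \<phi> \<theta> x
    using assms that by (simp add: bisimplicial_set_def simplicial_set_def)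
  have vv: "?V p m \<phi> (?V p q \<theta> x) = ?V p q (map ((!) \<theta>) \<phi>) x"
    if "\<phi> \<in> monotone_maps l m" "\<theta> \<in> monotone_maps m q" "x \<in> ?B p q" for l m p q \<phi> \<theta> x
    using assms that by (simp add: bisimplicial_set_def simplicial_set_def)
  have hv: "?H p n \<theta> (?V p q \<phi> x) = ?V m q \<phi> (?H p q \<theta> x)"
    if "\<theta> \<in> monotone_maps m p" "\<phi> \<in> monotone_maps n q" "x \<in> ?B p q" for m p n q \<theta> \<phi> x
    using assms that by (simp add: bisimplicial_set_def)
  show ?thesis
    unfolding simplicial_set_def diag_def sset.simps
  proof (intro conjI allI ballI)
    fix m n \<theta> x assume *: "\<theta> \<in> monotone_maps m n" "x \<in> ?B n n"
    then show "?H n (length \<theta> - 1) \<theta> (?V n n \<theta> x) \<in> ?B m m"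
      unfolding monotone_maps_length[OF *(1)] by (simp add: hc vc)
  next
    fix n x assume *: "x \<in> ?B n n"
    then show "?H n (length [0..<Suc n] - 1) [0..<Suc n] (?V n n [0..<Suc n] x) = x"
      unfolding monotone_maps_length[OF monotone_maps_id]
      by (simp add: hi[OF _ monotone_maps_id] vi[OF _ monotone_maps_id] del: upt_Suc)
  next
    fix l m n \<phi> \<theta> x
    assume *: "\<phi> \<in> monotone_maps l m" "\<theta> \<in> monotone_maps m n" "x \<in> ?B n n"
    have "?H m l \<phi> (?V m m \<phi> (?H n m \<theta> (?V n n \<theta> x))) =
        ?H m l \<phi> (?H n l \<theta> (?V n m \<phi> (?V n n \<theta> x)))"
      using hv[OF *(2,1) vc[OF *(3,2)]] by simp
    also have "\<dots> = ?H n l (map ((!) \<theta>) \<phi>) (?V n n (map ((!) \<theta>) \<phi>) x)"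
      using * by (simp add: vv hh[OF *(1,2)] vc[OF *(3) monotone_maps_comp[OF *(2,1)]])
    finally show "?H m (length \<phi> - 1) \<phi> (?V m m \<phi> (?H n (length \<theta> - 1) \<theta> (?V n n \<theta> x))) =
       ?H n (length (map ((!) \<theta>) \<phi>) - 1) (map ((!) \<theta>) \<phi>) (?V n n (map ((!) \<theta>) \<phi>) x)"
      by (simp only: length_map monotone_maps_length[OF *(1)] monotone_maps_length[OF *(2)])
  qed
qed

section \<open>The 1-simplex is an interval\<close>

lemma openin_quotient_topology:
  "openin (quotient_topology T R) U \<longleftrightarrow> U \<subseteq> topspace T // R \<and> openin T {x \<in> topspace T. R `` {x} \<in> U}"
proof -
  have "istopology (\<lambda>U. U \<subseteq> topspace T // R \<and> openin T {x \<in> topspace T. R `` {x} \<in> U})"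
  proof -
    have 1: "{x \<in> topspace T. R `` {x} \<in> V \<inter> W} =
      {x \<in> topspace T. R `` {x} \<in> V} \<inter> {x \<in> topspace T. R `` {x} \<in> W}" for V W by auto
    have 2: "{x \<in> topspace T. R `` {x} \<in> \<Union> K} = (\<Union>V\<in>K. {x \<in> topspace T. R `` {x} \<in> V})" for K by auto
    show ?thesis unfolding istopology_def 1 2 by blast
  qed
  then show ?thesis by (simp add: quotient_topology_def)
qed

lemma equiv_realization_rel: "equiv UNIV (realization_rel X)"
  unfolding realization_rel_def
  by (auto intro!: equivI refl_onI symI transI intro: equivclp_sym equivclp_trans)

lemma quotient_map_quotient_topology:
  assumes "equiv UNIV R"
  shows "quotient_map T (quotient_topology T R) (\<lambda>x. R `` {x})"
proof -
  have ts: "topspace (quotient_topology T R) = topspace T // R"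
  proof -
    have "openin (quotient_topology T R) (topspace T // R)"
      unfolding openin_quotient_topology by (simp add: quotientI cong: conj_cong)
    then show ?thesis
      by (meson openin_quotient_topology openin_subset openin_topspace subset_antisym)
  qed
  have "(\<lambda>x. R `` {x}) ` topspace T = topspace T // R"
    by (auto simp: quotient_def)
  then show ?thesis
    unfolding quotient_map_def ts by (auto simp: openin_quotient_topology)
qed

lemma simplex_push_comp:
  assumes "\<theta> \<in> monotone_maps m n" "x \<in> monotone_maps n k"
  shows "simplex_push (map ((!) x) \<theta>) t = simplex_push x (simplex_push \<theta> t)"
proof
  fix j
  have lt: "\<theta> ! i < length x" if "i < length \<theta>" for i
    using assms that by (force simp: monotone_maps_def subset_eq less_Suc_eq_le)
  have "simplex_push x (simplex_push \<theta> t) j =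
     sum t (\<Union>i\<in>{i. i < length x \<and> x ! i = j}. {k. k < length \<theta> \<and> \<theta> ! k = i})"
    unfolding simplex_push_def by (rule sum.UNION_disjoint[symmetric]) auto
  also have "(\<Union>i\<in>{i. i < length x \<and> x ! i = j}. {k. k < length \<theta> \<and> \<theta> ! k = i}) =
     {k. k < length (map ((!) x) \<theta>) \<and> map ((!) x) \<theta> ! k = j}"
    using lt by auto
  finally show "simplex_push (map ((!) x) \<theta>) t j = simplex_push x (simplex_push \<theta> t) j"
    by (simp add: simplex_push_def)
qed

lemma simplex_push_standard_simplex:
  assumes "\<theta> \<in> monotone_maps m n" "t \<in> standard_simplex m"
  shows "simplex_push \<theta> t \<in> standard_simplex n"
proof -
  have \<theta>: "length \<theta> = Suc m" "\<And>i. i \<le> m \<Longrightarrow> \<theta> ! i \<le> n"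
    using assms by (auto simp: monotone_maps_def subset_eq)
  have t: "\<And>i. 0 \<le> t i" "(\<Sum>i\<le>m. t i) = 1"
    using assms by (auto simp: standard_simplex_def)
  have ge0: "simplex_push \<theta> t j \<ge> 0" for j
    unfolding simplex_push_def by (rule sum_nonneg) (use t in auto)
  have le1: "simplex_push \<theta> t j \<le> 1" for j
    unfolding simplex_push_def t(2)[symmetric] by (rule sum_mono2) (use t \<theta> in auto)
  have out: "simplex_push \<theta> t j = 0" if "j > n" for j
    using that \<theta> by (fastforce simp: simplex_push_def less_Suc_eq_le intro!: sum.neutral)
  have "(\<Sum>j\<le>n. simplex_push \<theta> t j) = sum t (\<Union>j\<in>{..n}. {i. i < length \<theta> \<and> \<theta> ! i = j})"
    unfolding simplex_push_def by (rule sum.UNION_disjoint[symmetric]) auto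
  also have "(\<Union>j\<in>{..n}. {i. i < length \<theta> \<and> \<theta> ! i = j}) = {..m}"
    using \<theta> by (auto simp: less_Suc_eq_le)
  finally show ?thesis using ge0 le1 out t by (auto simp: standard_simplex_def)
qed

definition interval_coord :: "(nat \<times> nat list) \<times> (nat \<Rightarrow> real) \<Rightarrow> real" where
  "interval_coord = (\<lambda>((n, x), t). simplex_push x t 1)"

definition interval_point :: "real \<Rightarrow> (nat \<times> nat list) \<times> (nat \<Rightarrow> real)" where
  "interval_point r = ((1, [0,1]), \<lambda>j. if j = 0 then 1 - r else if j = 1 then r else 0)"

lemma interval_coord_step: "realization_step (std_simplex 1) u v \<Longrightarrow> interval_coord u = interval_coord v"
  by (induction rule: realization_step.induct)
    (simp add: interval_coord_def act_std_simplex simps_std_simplex simplex_push_comp)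

lemma interval_coord_equiv: "(u, v) \<in> realization_rel (std_simplex 1) \<Longrightarrow> interval_coord u = interval_coord v"
  unfolding realization_rel_def mem_Collect_eq prod.case
  by (induction rule: equivclp_induct) (use interval_coord_step in \<open>metis+\<close>)

lemma topspace_simplex_coproduct: "topspace (simplex_coproduct X) = {((n, x), t). x \<in> simps X n \<and> t \<in> standard_simplex n}"
  by (auto simp: simplex_coproduct_def)

lemma interval_point_coord:
  assumes "u \<in> topspace (simplex_coproduct (std_simplex 1))"
  shows "(u, interval_point (interval_coord u)) \<in> realization_rel (std_simplex 1)" "0 \<le> interval_coord u" "interval_coord u \<le> 1"
proof -
  obtain n x t where u: "u = ((n, x), t)" "x \<in> monotone_maps n 1" "t \<in> standard_simplex n"
    using assms by (auto simp: topspace_simplex_coproduct simps_std_simplex)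
  have p: "simplex_push x t \<in> standard_simplex 1" using simplex_push_standard_simplex u by blast
  then show "0 \<le> interval_coord u" "interval_coord u \<le> 1" by (auto simp: interval_coord_def u standard_simplex_def)
  have s: "interval_point (interval_coord u) = ((1, [0,1]), simplex_push x t)"
    using p by (auto simp: interval_point_def interval_coord_def u standard_simplex_def fun_eq_iff)
  have "map ((!) [0,1]) x = x"
    using u(2) by (force simp: monotone_maps_def subset_eq less_Suc_eq_le le_Suc_eq intro!: map_idI)
  moreover have "realization_step (std_simplex 1) ((n, act (std_simplex 1) 1 x [0,1]), t) ((1, [0,1]), simplex_push x t)"
    using u by (intro realization_step.intros) (auto simp: simps_std_simplex monotone_maps_def)
  ultimately show "(u, interval_point (interval_coord u)) \<in> realization_rel (std_simplex 1)"
    unfolding s unfolding realization_rel_def u by (auto simp: act_std_simplex)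
qed

lemma interval_coord_point: "interval_coord (interval_point r) = r"
proof -
  have "{i. i < Suc (Suc 0) \<and> [0, Suc 0] ! i = Suc 0} = {1}"
    by (auto simp: less_Suc_eq)
  then show ?thesis by (simp add: interval_coord_def interval_point_def simplex_push_def)
qed

lemma continuous_map_from_sum_topology:
  assumes "\<And>i. i \<in> I \<Longrightarrow> continuous_map (X i) Y (\<lambda>x. f (i, x))"
  shows "continuous_map (sum_topology X I) Y f"
  unfolding continuous_map_def
proof (intro conjI allI impI)
  show "f \<in> topspace (sum_topology X I) \<rightarrow> topspace Y"
    using assms by (fastforce simp: continuous_map_def)
  fix U assume "openin Y U"
  then have "openin (X i) {x \<in> topspace (X i). f (i, x) \<in> U}" if "i \<in> I" for i
    using assms[OF that] by (simp add: continuous_map_def)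
  moreover have "{x. (i, x) \<in> {x \<in> topspace (sum_topology X I). f x \<in> U}} =
      {x \<in> topspace (X i). f (i, x) \<in> U}" if "i \<in> I" for i
    using that by auto
  ultimately show "openin (sum_topology X I) {x \<in> topspace (sum_topology X I). f x \<in> U}"
    unfolding openin_sum_topology by auto
qed

lemma continuous_map_interval_coord: "continuous_map (simplex_coproduct (std_simplex 1)) (top_of_set {0..1}) interval_coord"
proof -
  have push: "continuous_map (subtopology (powertop_real UNIV) A) euclideanreal (\<lambda>t. simplex_push x t 1)" for A x
    unfolding simplex_push_def
    by (intro continuous_map_sum continuous_map_from_subtopology continuous_map_product_projection) auto
  have "continuous_map (simplex_coproduct (std_simplex 1)) euclideanreal interval_coord"
    unfolding simplex_coproduct_def
  proof (rule continuous_map_from_sum_topology, goal_cases)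
    case (1 i)
    show ?case using push by (cases i) (simp add: interval_coord_def)
  qed
  then show ?thesis using interval_point_coord by (auto simp: continuous_map_in_subtopology)
qed

lemma continuous_map_interval_point: "continuous_map (top_of_set {0..1}) (simplex_coproduct (std_simplex 1)) interval_point"
proof -
  let ?f = "\<lambda>r j. if j = (0::nat) then 1 - r else if j = 1 then r else (0::real)"
  have cont: "continuous_on {0..1} (\<lambda>r. ?f r k)" for k
    by (cases "k = 0"; cases "k = 1") (auto intro!: continuous_on_diff)
  have "continuous_map (top_of_set {0..1}) (subtopology (powertop_real UNIV) (standard_simplex 1)) ?f"
    unfolding continuous_map_in_subtopology continuous_map_componentwise_UNIV
      continuous_map_iff_continuous
    using cont by (intro conjI allI) (auto simp only:, auto simp: standard_simplex_def)
  moreover have "continuous_map (subtopology (powertop_real UNIV) (standard_simplex 1))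
     (simplex_coproduct (std_simplex 1)) (Pair (1, [0,1]))"
  proof -
    have "(1, [0,1]) \<in> (SIGMA n : UNIV. simps (std_simplex 1) n)"
      by (auto simp: simps_std_simplex monotone_maps_def)
    from continuous_map_component_injection[OF this, of "\<lambda>(n, x). subtopology (powertop_real UNIV) (standard_simplex n)"]
    show ?thesis unfolding simplex_coproduct_def by simp
  qed
  ultimately have "continuous_map (top_of_set {0..1}) (simplex_coproduct (std_simplex 1)) (Pair (1, [0,1]) \<circ> ?f)"
    by (rule continuous_map_compose)
  then show ?thesis by (simp add: o_def interval_point_def[abs_def])
qed

lemma simplicial_interval_std_simplex: "simplicial_interval (std_simplex 1) [0] [1]"
proof -
  let ?C = "simplex_coproduct (std_simplex 1)" and ?R = "realization_rel (std_simplex 1)"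
  let ?pi = "\<lambda>u. ?R `` {u}"
  define \<phi> where "\<phi> c = interval_coord (SOME u. u \<in> c)" for c
  have \<phi>: "\<phi> (?pi u) = interval_coord u" for u
  proof -
    have "u \<in> ?pi u" by (simp add: realization_rel_def equivclp_refl)
    then have "(SOME v. v \<in> ?pi u) \<in> ?pi u" by (rule someI)
    then show ?thesis unfolding \<phi>_def by (metis interval_coord_equiv Image_singleton_iff)
  qed
  have q: "quotient_map ?C (realization (std_simplex 1)) ?pi"
    unfolding realization_def by (rule quotient_map_quotient_topology[OF equiv_realization_rel])
  have "retraction_maps ?C (top_of_set {0..1}) interval_coord interval_point"
    unfolding retraction_maps_def using continuous_map_interval_coord continuous_map_interval_point interval_coord_point by auto
  then have qF: "quotient_map ?C (top_of_set {0..1}) (\<phi> \<circ> ?pi)"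
    using retraction_imp_quotient_map unfolding retraction_map_def o_def \<phi> by auto
  have c\<phi>: "continuous_map (realization (std_simplex 1)) (top_of_set {0..1}) \<phi>"
    using continuous_compose_quotient_map[OF q] qF quotient_imp_continuous_map by blast
  have "quotient_map (realization (std_simplex 1)) (top_of_set {0..1}) \<phi>"
    using quotient_map_from_composition[OF quotient_imp_continuous_map[OF q] c\<phi> qF] .
  moreover have "inj_on \<phi> (topspace (realization (std_simplex 1)))"
  proof -
    have *: "?pi u = ?pi v" if "u \<in> topspace ?C" "v \<in> topspace ?C" "interval_coord u = interval_coord v" for u v
      using equiv_class_eq[OF equiv_realization_rel interval_point_coord(1)[OF that(1)]]
        equiv_class_eq[OF equiv_realization_rel interval_point_coord(1)[OF that(2)]] that(3) by simp
    have "topspace (realization (std_simplex 1)) = ?pi ` topspace ?C"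
      using q by (simp add: quotient_map_def)
    then show ?thesis using * by (simp only: inj_on_def ball_simps \<phi>) blast
  qed
  ultimately have "homeomorphic_map (realization (std_simplex 1)) (top_of_set {0..1}) \<phi>"
    by (simp add: homeomorphic_map_def)
  moreover have "\<phi> (vertex_point (std_simplex 1) [0]) = 0" "\<phi> (vertex_point (std_simplex 1) [1]) = 1"
  proof -
    have "{i. i = 0 \<and> [Suc 0] ! i = Suc 0} = {0}" "{i. i = 0 \<and> [0] ! i = Suc 0} = {}" by auto
    then show "\<phi> (vertex_point (std_simplex 1) [0]) = 0" "\<phi> (vertex_point (std_simplex 1) [1]) = 1"
      unfolding vertex_point_def \<phi> by (auto simp: interval_coord_def simplex_push_def)
  qed
  ultimately show ?thesis
    using simplicial_set_std_simplex by (auto simp: simplicial_interval_def simps_std_simplex monotone_maps_def)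
qed

end

theory Submission
  imports Defs
begin

text \<open>
  A section \<open>\<rho> : \<Delta>\<^sup>n \<times> \<Delta>\<^sup>n \<rightarrow> X\<close> is sent to its restriction to the diagonal, and a simplex \<open>x\<close>
  of \<open>X\<close> to the section \<open>x \<circ> pr\<^sub>0\<close> over \<open>h(x)\<close>. Restricting \<open>x \<circ> pr\<^sub>0\<close> to the diagonal gives \<open>x\<close>
  back. The other composite takes \<open>\<rho>\<close> to \<open>(i, j) \<mapsto> \<rho>(i, i)\<close>. It is homotopic to the identity
  because the natural maps \<open>(i, j) \<mapsto> \<rho>(i, i)\<close> and \<open>(i, j) \<mapsto> \<rho>(i, j)\<close> both lie below
  \<open>(i, j) \<mapsto> \<rho>(i, max i j)\<close>, and changing only the second coordinate does not affect the height.
  The projections \<open>pr\<^sub>0\<close> and \<open>pr\<^sub>1\<close> being incomparable, there is no such homotopy over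
  \<open>\<Delta>\<^sup>1\<close>, and one needs an interval made of two opposite edges.
\<close>

section \<open>The horn is an interval\<close>

text \<open>The horn \<open>\<Lambda>\<^sup>2\<^sub>2\<close>, a model of the interval \<open>0 \<rightarrow> 2 \<leftarrow> 1\<close> with endpoints \<open>0\<close> and \<open>1\<close>.\<close>

definition horn :: "nat list sset" where
  "horn = (std_simplex 2)\<lparr>simps := (\<lambda>n. {\<theta> \<in> monotone_maps n 2. 0 \<notin> set \<theta> \<or> 1 \<notin> set \<theta>})\<rparr>"

lemma simps_horn: "simps horn n = {\<theta> \<in> monotone_maps n 2. 0 \<notin> set \<theta> \<or> 1 \<notin> set \<theta>}"
  by (simp add: horn_def)

lemma act_horn: "act horn n \<theta> x = map ((!) x) \<theta>"
  by (simp add: horn_def std_simplex_def nerve_def)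

lemma monotone_maps_nth: "\<theta> \<in> monotone_maps m n \<Longrightarrow> i \<le> m \<Longrightarrow> \<theta> ! i \<le> n"
  by (auto simp: monotone_maps_def subset_eq)

text \<open>For closure of the horn: a simplex that avoids \<open>0\<close> or \<open>1\<close>
  keeps avoiding it under every operator.\<close>

lemma set_map_nth_monotone_maps:
  assumes "\<theta> \<in> monotone_maps m n" "\<phi> \<in> monotone_maps l m"
  shows "set (map ((!) \<theta>) \<phi>) \<subseteq> set \<theta>"
  using assms by (force simp: monotone_maps_def subset_eq)

lemma simplicial_set_horn: "simplicial_set horn"
proof -
  have "map ((!) x) \<theta> \<in> simps horn m" if "\<theta> \<in> monotone_maps m n" "x \<in> simps horn n" for m n \<theta> x
    using that monotone_maps_comp set_map_nth_monotone_maps by (fastforce simp: simps_horn)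
  moreover have "map ((!) x) [0..<Suc n] = x" if "x \<in> simps horn n" for n x
    using that map_nth[of x] by (simp add: simps_horn monotone_maps_def del: upt_Suc)
  ultimately show ?thesis
    unfolding simplicial_set_def act_horn by (auto simp: simps_horn map_nth_assoc simp del: upt_Suc map_map)
qed

text \<open>The affine extension of the values 0, 1 and 1/2 at the vertices \<open>0\<close>,
  \<open>1\<close> and \<open>2\<close>: the apex of the horn goes to the midpoint.\<close>

definition horn_coord :: "(nat \<times> nat list) \<times> (nat \<Rightarrow> real) \<Rightarrow> real" where
  "horn_coord = (\<lambda>((n, x), t). simplex_push x t 1 + simplex_push x t 2 / 2)"

definition horn_edge :: "nat \<Rightarrow> real \<Rightarrow> (nat \<times> nat list) \<times> (nat \<Rightarrow> real)" where
  "horn_edge e r = ((1, [e, 2]), \<lambda>j. if j = 0 then 1 - r else if j = 1 then r else 0)"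

text \<open>A right inverse of \<open>horn_coord\<close> on representatives. It traverses the second
  edge backwards and changes the summand of the coproduct at 1/2, so continuity has to wait for the
  realization.\<close>

definition horn_point :: "real \<Rightarrow> (nat \<times> nat list) \<times> (nat \<Rightarrow> real)" where
  "horn_point r = (if r \<le> 1/2 then horn_edge 0 (2 * r) else horn_edge 1 (2 - 2 * r))"

lemma simplex_push_vertex: "simplex_push [e] t j = (if e = j then t 0 else 0)"
proof -
  have "{i. i < length [e] \<and> [e] ! i = j} = (if e = j then {0} else {})"
    by auto
  then show ?thesis
    unfolding simplex_push_def by simp
qed

text \<open>The coordinate depends only on the image of the point in the 2-simplex, and pushing
  points forward is functorial.\<close>

lemma horn_coord_step: "realization_step horn u v \<Longrightarrow> horn_coord u = horn_coord v"
  by (induction rule: realization_step.induct)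
    (auto simp: horn_coord_def act_horn simps_horn simplex_push_comp)

lemma horn_coord_equiv: "(u, v) \<in> realization_rel horn \<Longrightarrow> horn_coord u = horn_coord v"
  unfolding realization_rel_def mem_Collect_eq prod.case
  by (induction rule: equivclp_induct) (use horn_coord_step in \<open>metis+\<close>)

lemma horn_coord_edge:
  assumes "e = 0 \<or> e = 1"
  shows "horn_coord (horn_edge e r) = (if e = 0 then r / 2 else 1 - r / 2)"
proof -
  have "{i. i < Suc (Suc 0) \<and> [e, 2] ! i = 1} = (if e = 0 then {} else {0})"
    "{i. i < Suc (Suc 0) \<and> [e, 2] ! i = 2} = {1}"
    using assms by (auto simp: nth_Cons' less_Suc_eq split: if_splits)
  then show ?thesis using assms by (auto simp: horn_coord_def horn_edge_def simplex_push_def field_simps)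
qed

lemma horn_coord_point: "horn_coord (horn_point r) = r"
  by (auto simp: horn_point_def horn_coord_edge field_simps)

text \<open>The face \<open>[1]\<close> of either edge is the vertex \<open>[2]\<close>, so the
  point of that 0-simplex is identified with both ends.\<close>

lemma horn_edges_meet: "(horn_edge 0 1, horn_edge 1 1) \<in> realization_rel horn"
proof -
  let ?t = "\<lambda>j. if j = 0 then 1 else 0 :: real"
  have "equivclp (realization_step horn) ((0, [2]), ?t) (horn_edge e 1)" if "e = 0 \<or> e = 1" for e
  proof (rule r_into_equivclp)
    have "simplex_push [1] ?t = (\<lambda>j. if j = 0 then 1 - 1 else if j = 1 then 1 else 0)"
      by (auto simp: simplex_push_vertex fun_eq_iff)
    moreover have "realization_step horn ((0, act horn 1 [1] [e, 2]), ?t) ((1, [e, 2]), simplex_push [1] ?t)"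
      using that by (intro realization_step.intros) (auto simp: simps_horn monotone_maps_def standard_simplex_def)
    ultimately show "realization_step horn ((0, [2]), ?t) (horn_edge e 1)"
      by (simp add: act_horn horn_edge_def)
  qed
  from equivclp_trans[OF equivclp_sym[OF this[of 0]] this[of 1]] show ?thesis
    by (simp add: realization_rel_def)
qed

text \<open>A simplex of the horn misses \<open>0\<close> or \<open>1\<close>, so it factors through
  the edge from the other of these to \<open>2\<close>; pushing the point forward along the
  factorization lands on that edge.\<close>

lemma horn_edge_coord:
  assumes "u \<in> topspace (simplex_coproduct horn)"
  obtains e r where "e = 0 \<or> e = 1" "0 \<le> r" "r \<le> 1" "(u, horn_edge e r) \<in> realization_rel horn"
proof -
  obtain n x t where u: "u = ((n, x), t)" "x \<in> simps horn n" "t \<in> standard_simplex n"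
    using assms by (auto simp: topspace_simplex_coproduct)
  \<comment> \<open>Here \<open>1 - e\<close> exchanges 0 and 1: it is the vertex missed by
    \<open>x\<close>.\<close>
  obtain e where e: "e = 0 \<or> e = 1" "1 - e \<notin> set x"
  proof (cases "0 \<in> set x")
    case True
    then show ?thesis using u that[of 0] by (auto simp: simps_horn)
  qed (use that[of 1] in simp)
  \<comment> \<open>The operator with \<open>[e, 2]\<close> after \<open>y\<close> equal to
    \<open>x\<close>; it marks the positions of the apex.\<close>
  define y where "y = map (\<lambda>v. if v = 2 then 1 else 0 :: nat) x"
  have x: "length x = Suc n" "sorted x" "set x \<subseteq> {..2}"
    using u by (auto simp: simps_horn monotone_maps_def)
  have val: "v = e \<or> v = 2" if "v \<in> set x" for v
  proof -
    have "v \<le> 2" "v \<noteq> 1 - e" using that x(3) e(2) by auto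
    then show ?thesis using e(1) by arith
  qed
  have "sorted y"
    unfolding y_def sorted_map by (rule sorted_wrt_mono_rel[OF _ x(2)]) (use x(3) in auto)
  then have y: "y \<in> monotone_maps n 1"
    using x by (auto simp: monotone_maps_def y_def)
  have yx: "map ((!) [e, 2]) y = x"
    using val by (force simp: y_def comp_def intro!: map_idI)
  define p where "p = simplex_push y t"
  have p: "p \<in> standard_simplex 1" using simplex_push_standard_simplex y u unfolding p_def by blast
  have "realization_step horn ((n, act horn 1 y [e, 2]), t) ((1, [e, 2]), p)"
    unfolding p_def using u y e by (intro realization_step.intros) (auto simp: simps_horn monotone_maps_def)
  moreover have "((1, [e, 2]), p) = horn_edge e (p 1)"
    using p by (auto simp: horn_edge_def standard_simplex_def fun_eq_iff)
  ultimately have "(u, horn_edge e (p 1)) \<in> realization_rel horn"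
    by (simp add: realization_rel_def act_horn yx u r_into_equivclp)
  moreover have "0 \<le> p 1" "p 1 \<le> 1" using p by (auto simp: standard_simplex_def)
  ultimately show ?thesis using that e by blast
qed

lemma horn_point_coord:
  assumes "u \<in> topspace (simplex_coproduct horn)"
  shows "(u, horn_point (horn_coord u)) \<in> realization_rel horn" "0 \<le> horn_coord u" "horn_coord u \<le> 1"
proof -
  have sym_realization: "sym (realization_rel horn)" and trans_realization: "trans (realization_rel horn)"
    using equiv_realization_rel[of horn] by (auto elim: equivE)
  obtain e r where e: "e = 0 \<or> e = 1" "0 \<le> r" "r \<le> 1" "(u, horn_edge e r) \<in> realization_rel horn"
    using horn_edge_coord[OF assms] .
  have c: "horn_coord u = (if e = 0 then r / 2 else 1 - r / 2)"
    using horn_coord_equiv[OF e(4)] horn_coord_edge[OF e(1)] by simp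
  show "0 \<le> horn_coord u" "horn_coord u \<le> 1" using e c by auto
  have "(horn_edge e r, horn_point (horn_coord u)) \<in> realization_rel horn"
  \<comment> \<open>At the apex of the second edge the coordinate is 1/2, where
    \<open>horn_point\<close> uses the first edge: the representatives differ and only their classes
    agree.\<close>
  proof (cases "e = 1 \<and> r = 1")
    case True
    then have "horn_edge e r = horn_edge 1 1" "horn_point (horn_coord u) = horn_edge 0 1"
      by (simp_all add: c horn_point_def)
    then show ?thesis using symD[OF sym_realization horn_edges_meet] by simp
  next
    case False
    then have "horn_point (horn_coord u) = horn_edge e r"
      using e by (auto simp: c horn_point_def field_simps)
    then show ?thesis by (simp add: realization_rel_def)
  qed
  then show "(u, horn_point (horn_coord u)) \<in> realization_rel horn"
    using transD[OF trans_realization e(4)] by simp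
qed

lemma continuous_map_horn_coord:
  "continuous_map (simplex_coproduct horn) (top_of_set {0..1}) horn_coord"
proof -
  have push: "continuous_map (subtopology (powertop_real UNIV) A) euclideanreal (\<lambda>t. simplex_push x t j)" for A x j
    unfolding simplex_push_def
    by (intro continuous_map_sum continuous_map_from_subtopology continuous_map_product_projection) auto
  have "continuous_map (simplex_coproduct horn) euclideanreal horn_coord"
    unfolding simplex_coproduct_def
  proof (rule continuous_map_from_sum_topology)
    fix i
    have "continuous_map (subtopology (powertop_real UNIV) (standard_simplex (fst i))) euclideanreal
        (\<lambda>t. simplex_push (snd i) t 1 + simplex_push (snd i) t 2 * (1/2))"
      by (intro continuous_map_add continuous_map_real_mult_right push)
    then show "continuous_map (case i of (n, x) \<Rightarrow> subtopology (powertop_real UNIV) (standard_simplex n))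
        euclideanreal (\<lambda>t. horn_coord (i, t))"
      by (cases i) (simp add: horn_coord_def)
  qed
  then show ?thesis using horn_point_coord by (auto simp: continuous_map_in_subtopology)
qed

lemma continuous_map_horn_edge:
  assumes "e = 0 \<or> e = 1"
  shows "continuous_map (top_of_set {0..1}) (simplex_coproduct horn) (horn_edge e)"
proof -
  let ?f = "\<lambda>r j. if j = (0::nat) then 1 - r else if j = 1 then r else (0::real)"
  have cont: "continuous_on {0..1} (\<lambda>r. ?f r k)" for k
    by (cases "k = 0"; cases "k = 1") (auto intro!: continuous_on_diff)
  have "continuous_map (top_of_set {0..1}) (subtopology (powertop_real UNIV) (standard_simplex 1)) ?f"
    unfolding continuous_map_in_subtopology continuous_map_componentwise_UNIV
      continuous_map_iff_continuous
    using cont by (intro conjI allI) (auto simp only:, auto simp: standard_simplex_def)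
  moreover have "continuous_map (subtopology (powertop_real UNIV) (standard_simplex 1))
     (simplex_coproduct horn) (Pair (1, [e, 2]))"
  proof -
    have "(1, [e, 2]) \<in> (SIGMA n : UNIV. simps horn n)"
      using assms by (auto simp: simps_horn monotone_maps_def)
    from continuous_map_component_injection[OF this, of "\<lambda>(n, x). subtopology (powertop_real UNIV) (standard_simplex n)"]
    show ?thesis unfolding simplex_coproduct_def by simp
  qed
  ultimately have "continuous_map (top_of_set {0..1}) (simplex_coproduct horn) (Pair (1, [e, 2]) \<circ> ?f)"
    by (rule continuous_map_compose)
  then show ?thesis by (simp add: o_def horn_edge_def[abs_def])
qed

text \<open>The coordinate descends to classes. Its inverse is the class of
  \<open>horn_point\<close>, pasted from the two edges, which agree at 1/2 by
  \<open>horn_edges_meet\<close>.\<close>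

lemma simplicial_interval_horn: "simplicial_interval horn [0] [1]"
proof -
  let ?C = "simplex_coproduct horn" and ?R = "realization_rel horn" and ?I = "top_of_set {0..1::real}"
  let ?pi = "\<lambda>u. ?R `` {u}"
  define \<phi> where "\<phi> c = horn_coord (SOME u. u \<in> c)" for c
  have \<phi>: "\<phi> (?pi u) = horn_coord u" for u
  proof -
    have "u \<in> ?pi u" by (simp add: realization_rel_def equivclp_refl)
    then have "(SOME v. v \<in> ?pi u) \<in> ?pi u" by (rule someI)
    then show ?thesis unfolding \<phi>_def by (metis horn_coord_equiv Image_singleton_iff)
  qed
  have q: "quotient_map ?C (realization horn) ?pi"
    unfolding realization_def by (rule quotient_map_quotient_topology[OF equiv_realization_rel])
  have c\<phi>: "continuous_map (realization horn) ?I \<phi>"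
    using continuous_compose_quotient_map[OF q, of ?I \<phi>] continuous_map_horn_coord by (simp add: o_def \<phi>)
  have edge: "continuous_map (top_of_set S) (realization horn) (\<lambda>r. ?pi (horn_edge e (g r)))"
    if "e = 0 \<or> e = 1" "continuous_on S g" "g \<in> S \<rightarrow> {0..1}" for e S g
  proof -
    have "continuous_map (top_of_set S) ?I g"
      using that by (simp add: continuous_map_in_subtopology image_subset_iff_funcset)
    from continuous_map_compose[OF continuous_map_compose[OF this continuous_map_horn_edge[OF that(1)]]
        quotient_imp_continuous_map[OF q]]
    show ?thesis by (simp add: o_def)
  qed
  have "continuous_map ?I (realization horn)
     (\<lambda>r. if r \<le> 1/2 then ?pi (horn_edge 0 (2 * r)) else ?pi (horn_edge 1 (2 - 2 * r)))"
  proof (rule continuous_map_cases_le)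
    show "continuous_map (subtopology ?I {x \<in> topspace ?I. x \<le> 1/2}) (realization horn)
        (\<lambda>r. ?pi (horn_edge 0 (2 * r)))"
      unfolding subtopology_subtopology by (rule edge) (auto intro!: continuous_intros)
    show "continuous_map (subtopology ?I {x \<in> topspace ?I. 1/2 \<le> x}) (realization horn)
        (\<lambda>r. ?pi (horn_edge 1 (2 - 2 * r)))"
      unfolding subtopology_subtopology by (rule edge) (auto intro!: continuous_intros)
    show "?pi (horn_edge 0 (2 * r)) = ?pi (horn_edge 1 (2 - 2 * r))" if "r = 1/2" for r
    proof -
      have "2 * r = 1" "2 - 2 * r = 1" using that by auto
      then show ?thesis using equiv_class_eq[OF equiv_realization_rel horn_edges_meet] by simp
    qed
  qed auto
  then have cs: "continuous_map ?I (realization horn) (\<lambda>r. ?pi (horn_point r))"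
    unfolding horn_point_def if_distrib[of ?pi] .
  have "topspace (realization horn) = ?pi ` topspace ?C"
    using q by (simp add: quotient_map_def)
  then have "homeomorphic_maps (realization horn) ?I \<phi> (\<lambda>r. ?pi (horn_point r))"
    unfolding homeomorphic_maps_def
    using c\<phi> cs equiv_class_eq[OF equiv_realization_rel horn_point_coord(1)]
    by (auto simp: \<phi> horn_coord_point)
  then have "homeomorphic_map (realization horn) ?I \<phi>"
    by (auto simp: homeomorphic_map_maps)
  moreover have "\<phi> (vertex_point horn [0]) = 0" "\<phi> (vertex_point horn [1]) = 1"
    unfolding vertex_point_def \<phi> by (simp_all add: horn_coord_def simplex_push_vertex)
  ultimately show ?thesis
    using simplicial_set_horn by (auto simp: simplicial_interval_def simps_horn monotone_maps_def)
qed

section \<open>Contracting a section onto the diagonal\<close>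

lemma simps_diag_section_complex:
  "simps (diag (section_complex X h)) n = (SIGMA a : simps real_line n. sections X h n a n)"
  by (simp add: diag_def bisimps_section_complex)

lemma act_diag_section_complex:
  assumes "\<theta> \<in> monotone_maps m n"
  shows "act (diag (section_complex X h)) n \<theta> (a, \<rho>) = (act real_line n \<theta> a,
     \<lambda>k. \<lambda>(\<sigma>, \<tau>)\<in>monotone_maps k m \<times> monotone_maps k m. \<rho> k (map ((!) \<theta>) \<sigma>, map ((!) \<theta>) \<tau>))"
  using assms monotone_maps_length[OF assms]
  by (auto simp: diag_def vact_eq hact_eq fun_eq_iff monotone_maps_comp)

lemma sections_nth:
  assumes "\<rho> \<in> sections X h p a q" "\<sigma> \<in> monotone_maps n p" "\<tau> \<in> monotone_maps n q"
  shows sections_in_simps: "\<rho> n (\<sigma>, \<tau>) \<in> simps X n"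
    and sections_height: "h n (\<rho> n (\<sigma>, \<tau>)) = act real_line p \<sigma> a"
    and sections_act: "\<psi> \<in> monotone_maps j n \<Longrightarrow>
      \<rho> j (map ((!) \<sigma>) \<psi>, map ((!) \<tau>) \<psi>) = act X n \<psi> (\<rho> n (\<sigma>, \<tau>))"
  using assms
  by (fastforce simp: in_sections simplicial_maps_def sprod_def simps_std_simplex act_std_simplex)+

section \<open>Self-maps of \<open>\<Delta>^n \<times> \<Delta>^n\<close> over the first
  factor\<close>

definition monotone2 :: "nat \<Rightarrow> (nat \<Rightarrow> nat \<Rightarrow> nat) \<Rightarrow> bool" where
  "monotone2 n F \<longleftrightarrow> (\<forall>i j i' j'. i \<le> i' \<longrightarrow> i' \<le> n \<longrightarrow> j \<le> j' \<longrightarrow> j' \<le> n \<longrightarrow> F i j \<le> F i' j' \<and> F i' j' \<le> n)"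

lemma map2_monotone_maps:
  assumes F: "monotone2 n F" and "\<sigma> \<in> monotone_maps k n" "\<tau> \<in> monotone_maps k n"
  shows "map2 F \<sigma> \<tau> \<in> monotone_maps k n"
proof -
  have l: "length \<sigma> = Suc k" "length \<tau> = Suc k" "sorted \<sigma>" "sorted \<tau>"
    using assms by (auto simp: monotone_maps_def)
  have b: "\<sigma> ! i \<le> n" "\<tau> ! i \<le> n" if "i \<le> k" for i
    using assms that monotone_maps_nth by blast+
  have s: "\<sigma> ! i \<le> \<sigma> ! j" "\<tau> ! i \<le> \<tau> ! j" if "i \<le> j" "j \<le> k" for i j
    using that l by (auto intro!: sorted_nth_mono)
  have "sorted (map2 F \<sigma> \<tau>)"
    unfolding sorted_iff_nth_mono using l F b s by (auto simp: monotone2_def less_Suc_eq_le)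
  moreover have "F (\<sigma> ! i) (\<tau> ! i) \<le> n" if "i \<le> k" for i
    using F b[OF that] unfolding monotone2_def by blast
  ultimately show ?thesis
    using l by (auto simp: monotone_maps_def set_zip less_Suc_eq_le)
qed

lemma map2_map_nth:
  assumes "\<sigma> \<in> monotone_maps k n" "\<tau> \<in> monotone_maps k n" "\<psi> \<in> monotone_maps j k"
  shows "map2 F (map ((!) \<sigma>) \<psi>) (map ((!) \<tau>) \<psi>) = map ((!) (map2 F \<sigma> \<tau>)) \<psi>"
proof -
  have "\<psi> ! i \<le> k" if "i < length \<psi>" for i
    using assms(3) that by (auto simp: monotone_maps_def subset_eq)
  then show ?thesis
    using assms(1,2) by (intro nth_equalityI) (auto simp: monotone_maps_def less_Suc_eq_le)
qed

text \<open>Precomposition of \<open>\<rho>\<close> with the map \<open>(pr_0, F)\<close>, where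
  \<open>map2\<close> applies \<open>F\<close> vertex by vertex.\<close>

definition twist :: "nat \<Rightarrow> (nat \<Rightarrow> nat \<Rightarrow> nat) \<Rightarrow> (nat \<Rightarrow> nat list \<times> nat list \<Rightarrow> 'a) \<Rightarrow>
    nat \<Rightarrow> nat list \<times> nat list \<Rightarrow> 'a" where
  "twist n F \<rho> k = (\<lambda>(\<sigma>, \<tau>)\<in>monotone_maps k n \<times> monotone_maps k n. \<rho> k (\<sigma>, map2 F \<sigma> \<tau>))"

text \<open>The height of a section depends only on the first coordinate, which the twist leaves
  alone. Simpliciality comes from the compatibility of \<open>map2 F\<close> with operators.\<close>

lemma twist_sections:
  assumes F: "monotone2 n F" and \<rho>: "\<rho> \<in> sections X h n a n"
  shows "twist n F \<rho> \<in> sections X h n a n"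
proof -
  have "\<rho> j (map ((!) \<sigma>) \<psi>, map2 F (map ((!) \<sigma>) \<psi>) (map ((!) \<tau>) \<psi>)) =
      act X k \<psi> (\<rho> k (\<sigma>, map2 F \<sigma> \<tau>))"
    if "\<psi> \<in> monotone_maps j k" "\<sigma> \<in> monotone_maps k n" "\<tau> \<in> monotone_maps k n" for j k \<psi> \<sigma> \<tau>
    unfolding map2_map_nth[OF that(2,3,1)]
    using sections_act[OF \<rho> that(2) map2_monotone_maps[OF F that(2,3)] that(1)] .
  then show ?thesis
    unfolding in_sections simplicial_maps_def
    using sections_in_simps[OF \<rho>] sections_height[OF \<rho>] map2_monotone_maps[OF F] monotone_maps_comp
    by (auto simp: sprod_def simps_std_simplex act_std_simplex twist_def simp del: map_map)
qed

text \<open>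
  A simplex \<open>t\<close> of the horn interpolates between the two projections, which belong to the
  endpoints \<open>0\<close> and \<open>1\<close>; the vertex \<open>2\<close> gives \<open>max\<close>. Since the formula only compares \<open>i\<close> with
  \<open>j\<close> and inspects \<open>t\<close> at \<open>i\<close> and \<open>j\<close>, it is natural in the simplex category.
\<close>

definition interpolation :: "nat list \<Rightarrow> nat \<Rightarrow> nat \<Rightarrow> nat" where
  "interpolation t i j = (if t ! i = 1 then j else if t ! j = 0 then i else max i j)"

text \<open>Here the horn matters. If \<open>t\<close> avoids 1, the value is \<open>i\<close> as
  long as \<open>t ! j = 0\<close> and \<open>max i j\<close> otherwise; if \<open>t\<close> avoids
  0, it is \<open>j\<close> as long as \<open>t ! i = 1\<close> and \<open>max i j\<close>
  otherwise. Since \<open>t\<close> is sorted, each switch goes upwards. With both values present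
  this can fail: for \<open>t = [0, 0, 1]\<close> the value drops from 1 at (1, 0) to 0 at (2,
  0).\<close>

lemma monotone2_interpolation:
  assumes "t \<in> simps horn n"
  shows "monotone2 n (interpolation t)"
proof -
  have t: "length t = Suc n" "0 \<notin> set t \<or> 1 \<notin> set t" "sorted t"
    using assms by (auto simp: simps_horn monotone_maps_def)
  have m: "t ! i \<le> t ! j" if "i \<le> j" "j \<le> n" for i j
    using t that by (auto intro!: sorted_nth_mono)
  have "interpolation t i j \<le> interpolation t i' j' \<and> interpolation t i' j' \<le> n"
    if "i \<le> i'" "i' \<le> n" "j \<le> j'" "j' \<le> n" for i j i' j'
  proof (cases "0 \<in> set t")
    case True
    then have "t ! k \<noteq> 1" if "k \<le> n" for k
      using t that nth_mem[of k t] by (metis less_Suc_eq_le)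
    from this[of i] this[of i'] show ?thesis
      using that m[of j j'] by (auto simp: interpolation_def max_def)
  next
    case False
    then have "t ! k \<noteq> 0" if "k \<le> n" for k
      using t that nth_mem[of k t] by (metis less_Suc_eq_le)
    from this[of i] this[of j] this[of j'] show ?thesis
      using that m[of i i'] by (auto simp: interpolation_def max_def)
  qed
  then show ?thesis unfolding monotone2_def by blast
qed

text \<open>Testing \<open>t\<close> at \<open>\<theta> ! i\<close> is testing
  \<open>map ((!) t) \<theta>\<close> at \<open>i\<close>, so both sides take the same branch, and a
  monotone map commutes with \<open>max\<close>.\<close>

lemma interpolation_natural:
  assumes \<theta>: "\<theta> \<in> monotone_maps m n" and "\<sigma> \<in> monotone_maps k m" "\<tau> \<in> monotone_maps k m"
  shows "map2 (interpolation t) (map ((!) \<theta>) \<sigma>) (map ((!) \<theta>) \<tau>) =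
    map ((!) \<theta>) (map2 (interpolation (map ((!) t) \<theta>)) \<sigma> \<tau>)"
proof (rule nth_equalityI)
  show "length (map2 (interpolation t) (map ((!) \<theta>) \<sigma>) (map ((!) \<theta>) \<tau>)) =
    length (map ((!) \<theta>) (map2 (interpolation (map ((!) t) \<theta>)) \<sigma> \<tau>))" by simp
  fix i assume "i < length (map2 (interpolation t) (map ((!) \<theta>) \<sigma>) (map ((!) \<theta>) \<tau>))"
  then have i: "i < length \<sigma>" "i < length \<tau>" "\<sigma> ! i \<le> m" "\<tau> ! i \<le> m"
    using assms by (auto simp: monotone_maps_nth monotone_maps_def subset_eq)
  have l: "length \<theta> = Suc m" "sorted \<theta>" using \<theta> by (auto simp: monotone_maps_def)
  have "\<theta> ! max (\<sigma> ! i) (\<tau> ! i) = max (\<theta> ! (\<sigma> ! i)) (\<theta> ! (\<tau> ! i))"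
    using i l sorted_nth_mono[OF l(2), of "\<sigma> ! i" "\<tau> ! i"] sorted_nth_mono[OF l(2), of "\<tau> ! i" "\<sigma> ! i"]
    by (auto simp: max_def)
  then show "map2 (interpolation t) (map ((!) \<theta>) \<sigma>) (map ((!) \<theta>) \<tau>) ! i =
    map ((!) \<theta>) (map2 (interpolation (map ((!) t) \<theta>)) \<sigma> \<tau>) ! i"
    using i l by (simp add: interpolation_def)
qed

lemma twist_natural:
  assumes "t \<in> simps horn n" "\<theta> \<in> monotone_maps m n"
    and "(a, \<rho>) \<in> simps (diag (section_complex X h)) n"
  shows "act (diag (section_complex X h)) n \<theta> (a, twist n (interpolation t) \<rho>) =
    (case act (diag (section_complex X h)) n \<theta> (a, \<rho>) of
      (b, \<upsilon>) \<Rightarrow> (b, twist m (interpolation (act horn n \<theta> t)) \<upsilon>))"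
proof -
  have t: "map ((!) t) \<theta> \<in> simps horn m"
    using simplicial_set_horn assms act_horn unfolding simplicial_set_def by metis
  show ?thesis
    unfolding act_diag_section_complex[OF assms(2)] act_horn prod.case prod.inject twist_def fun_eq_iff
    using map2_monotone_maps[OF monotone2_interpolation[OF t]] monotone_maps_comp[OF assms(2)]
    by (auto simp: interpolation_natural[OF assms(2)] simp del: map_map)
qed

section \<open>The two maps between the diagonal and \<open>X\<close>\<close>

definition diagonal_restriction ::
    "'a sset \<Rightarrow> (nat \<Rightarrow> 'a \<Rightarrow> real list) \<Rightarrow>
     nat \<Rightarrow> real list \<times> (nat \<Rightarrow> nat list \<times> nat list \<Rightarrow> 'a) \<Rightarrow> 'a" where
  "diagonal_restriction X h n =
     (\<lambda>(a, \<rho>)\<in>simps (diag (section_complex X h)) n. \<rho> n ([0..<Suc n], [0..<Suc n]))"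

definition constant_section ::
    "'a sset \<Rightarrow> (nat \<Rightarrow> 'a \<Rightarrow> real list) \<Rightarrow>
     nat \<Rightarrow> 'a \<Rightarrow> real list \<times> (nat \<Rightarrow> nat list \<times> nat list \<Rightarrow> 'a)" where
  "constant_section X h n =
     (\<lambda>x\<in>simps X n. (h n x, \<lambda>k. \<lambda>(\<sigma>, \<tau>)\<in>monotone_maps k n \<times> monotone_maps k n. act X n \<sigma> x))"

text \<open>By Yoneda, restriction to the diagonal is evaluation at the pair of identities.
  Operators of the diagonal act on both coordinates, so both sides of the naturality square are
  \<open>\<rho> m (\<theta>, \<theta>)\<close>.\<close>

lemma diagonal_restriction_simplicial:
  "diagonal_restriction X h \<in> simplicial_maps (diag (section_complex X h)) X"
proof -
  let ?D = "diag (section_complex X h)"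
  have D: "act ?D n \<theta> x \<in> simps ?D m" if "\<theta> \<in> monotone_maps m n" "x \<in> simps ?D n" for m n \<theta> x
    using simplicial_set_diag[OF bisimplicial_set_section_complex, of X h] that
    unfolding simplicial_set_def by blast
  have "diagonal_restriction X h m (act ?D n \<theta> x) = act X n \<theta> (diagonal_restriction X h n x)"
    if \<theta>: "\<theta> \<in> monotone_maps m n" and x: "x \<in> simps ?D n" for m n \<theta> x
  proof -
    obtain a \<rho> where a: "x = (a, \<rho>)" "\<rho> \<in> sections X h n a n"
      using x by (auto simp: simps_diag_section_complex)
    have id: "map ((!) \<theta>) [0..<Suc m] = \<theta>"
      using \<theta> map_nth[of \<theta>] by (simp add: monotone_maps_def del: upt_Suc)
    have "\<rho> m (\<theta>, \<theta>) = act X n \<theta> (\<rho> n ([0..<Suc n], [0..<Suc n]))"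
      using sections_act[OF a(2) monotone_maps_id monotone_maps_id \<theta>]
      by (simp add: map_id_op[OF \<theta>] del: upt_Suc)
    then show ?thesis
      using D[OF \<theta> x] x
      by (simp add: diagonal_restriction_def a(1) act_diag_section_complex[OF \<theta>] monotone_maps_id id
          del: upt_Suc)
  qed
  moreover have "diagonal_restriction X h n \<in> simps ?D n \<rightarrow>\<^sub>E simps X n" for n
    using sections_in_simps[OF _ monotone_maps_id monotone_maps_id]
    by (auto simp: diagonal_restriction_def simps_diag_section_complex simp del: upt_Suc)
  ultimately show ?thesis unfolding simplicial_maps_def by blast
qed

text \<open>The section lies over \<open>h n x\<close> because \<open>h\<close> commutes with
  operators; the rest is associativity of the action.\<close>

lemma constant_section_simplicial:
  assumes X: "simplicial_set X" and h: "h \<in> simplicial_maps X real_line"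
  shows "constant_section X h \<in> simplicial_maps X (diag (section_complex X h))"
proof -
  have cl: "act X n \<theta> x \<in> simps X m" if "\<theta> \<in> monotone_maps m n" "x \<in> simps X n" for m n \<theta> x
    using X that unfolding simplicial_set_def by blast
  have aa: "act X m \<phi> (act X n \<theta> x) = act X n (map ((!) \<theta>) \<phi>) x"
    if "\<phi> \<in> monotone_maps l m" "\<theta> \<in> monotone_maps m n" "x \<in> simps X n" for l m n \<phi> \<theta> x
    using X that unfolding simplicial_set_def by blast
  have ha: "h m (act X n \<theta> x) = act real_line n \<theta> (h n x)" 
    if "\<theta> \<in> monotone_maps m n" "x \<in> simps X n" for m n \<theta> x
    using h that unfolding simplicial_maps_def by blast
  have hc: "h n x \<in> simps real_line n" if "x \<in> simps X n" for n x
    using h that unfolding simplicial_maps_def by auto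
  have "constant_section X h n x \<in> simps (diag (section_complex X h)) n" if "x \<in> simps X n" for n x
    using that hc cl aa ha monotone_maps_comp
    by (auto simp: constant_section_def simps_diag_section_complex in_sections simplicial_maps_def sprod_def
        simps_std_simplex act_std_simplex simp del: map_map)
  moreover have "constant_section X h m (act X n \<theta> x) =
      act (diag (section_complex X h)) n \<theta> (constant_section X h n x)"
    if "\<theta> \<in> monotone_maps m n" "x \<in> simps X n" for m n \<theta> x
    using that
    by (auto simp: constant_section_def cl ha act_diag_section_complex aa monotone_maps_comp
        intro!: restrict_cong2 simp del: map_map)
  ultimately show ?thesis
    unfolding simplicial_maps_def by (auto simp: constant_section_def)
qed

lemma diagonal_restriction_constant_section:
  assumes X: "simplicial_set X" and h: "h \<in> simplicial_maps X real_line"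
  shows "scomp X (diagonal_restriction X h) (constant_section X h) = sid X"
proof (intro ext)
  fix n x
  show "scomp X (diagonal_restriction X h) (constant_section X h) n x = sid X n x"
  proof (cases "x \<in> simps X n")
    case True
    then have "constant_section X h n x \<in> simps (diag (section_complex X h)) n"
      using constant_section_simplicial[OF assms] unfolding simplicial_maps_def by auto
    moreover have "act X n [0..<Suc n] x = x" using X True unfolding simplicial_set_def by blast
    ultimately show ?thesis
      using True by (simp add: scomp_def compose_def sid_def diagonal_restriction_def constant_section_def
          monotone_maps_id del: upt_Suc)
  qed (simp add: scomp_def compose_def sid_def)
qed

text \<open>The constant homotopy: \<open>f\<close> after the projection away from the interval
  \<Delta>^1.\<close>

lemma shomotopic_refl:
  assumes "f \<in> simplicial_maps Y Z" "simplicial_set Y"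
  shows "shomotopic Y Z f f"
proof -
  let ?I = "std_simplex 1"
  have I: "[0] \<in> simps ?I 0" "[1] \<in> simps ?I 0" "simplicial_set ?I"
    using simplicial_interval_std_simplex by (auto simp: simplicial_interval_def)
  have v: "act ?I 0 (replicate (Suc n) 0) e \<in> simps ?I n" if "e \<in> simps ?I 0" for n e
  proof -
    have "replicate (Suc n) 0 \<in> monotone_maps n 0" by (auto simp: monotone_maps_def)
    then show ?thesis using I(3) that unfolding simplicial_set_def by blast
  qed
  let ?H = "scomp (sprod Y ?I) f (sfst Y ?I)"
  have "?H \<in> simplicial_maps (sprod Y ?I) Z"
    using scomp_simplicial[OF simplicial_set_sprod[OF assms(2) I(3)] sfst_simplicial[OF assms(2) I(3)] assms(1)] .
  moreover have "?H n (y, x) = f n y" if "y \<in> simps Y n" "x \<in> simps ?I n" for n y x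
    using that by (simp add: scomp_def compose_def sfst_def sprod_def)
  ultimately show ?thesis
    unfolding shomotopic_def using simplicial_interval_std_simplex v I by blast
qed

section \<open>The homotopy parametrized by the horn\<close>

definition section_homotopy ::
    "'a sset \<Rightarrow> (nat \<Rightarrow> 'a \<Rightarrow> real list) \<Rightarrow>
     nat \<Rightarrow> (real list \<times> (nat \<Rightarrow> nat list \<times> nat list \<Rightarrow> 'a)) \<times> nat list \<Rightarrow>
       real list \<times> (nat \<Rightarrow> nat list \<times> nat list \<Rightarrow> 'a)" where
  "section_homotopy X h n =
     (\<lambda>((a, \<rho>), t)\<in>simps (sprod (diag (section_complex X h)) horn) n. (a, twist n (interpolation t) \<rho>))"

lemma section_homotopy_simplicial:
  "section_homotopy X h \<in>
     simplicial_maps (sprod (diag (section_complex X h)) horn) (diag (section_complex X h))"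
proof -
  let ?D = "diag (section_complex X h)"
  have c: "act (sprod ?D horn) n \<theta> x \<in> simps (sprod ?D horn) m"
    if "\<theta> \<in> monotone_maps m n" "x \<in> simps (sprod ?D horn) n" for m n \<theta> x
    using simplicial_set_sprod[OF simplicial_set_diag[OF bisimplicial_set_section_complex, of X h]
        simplicial_set_horn] that
    unfolding simplicial_set_def by blast
  have "section_homotopy X h m (act (sprod ?D horn) n \<theta> x) = act ?D n \<theta> (section_homotopy X h n x)"
    if \<theta>: "\<theta> \<in> monotone_maps m n" and x: "x \<in> simps (sprod ?D horn) n" for m n \<theta> x
  proof -
    obtain a \<rho> t where a: "x = ((a, \<rho>), t)" "(a, \<rho>) \<in> simps ?D n" "t \<in> simps horn n"
      using x by (auto simp: sprod_def)
    show ?thesis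
      using c[OF \<theta> x] x twist_natural[OF a(3) \<theta> a(2)]
      by (simp add: section_homotopy_def a(1) split_beta) (simp add: sprod_def)
  qed
  moreover have "section_homotopy X h n \<in> simps (sprod ?D horn) n \<rightarrow>\<^sub>E simps ?D n" for n
    using twist_sections[OF monotone2_interpolation]
    by (auto simp: section_homotopy_def sprod_def simps_diag_section_complex)
  ultimately show ?thesis unfolding simplicial_maps_def by blast
qed

lemma vertex_horn: "act horn 0 (replicate (Suc n) 0) [e] = replicate (Suc n) e"
  by (simp add: act_horn)

text \<open>For the two ends of the homotopy: at constant 0 the test \<open>t ! j = 0\<close> always
  succeeds and returns \<open>i\<close>, at constant 1 the test \<open>t ! i = 1\<close> returns
  \<open>j\<close>.\<close>

lemma map2_const_interpolation:
  assumes "\<sigma> \<in> monotone_maps k n" "\<tau> \<in> monotone_maps k n"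
  shows "map2 (interpolation (replicate (Suc n) 0)) \<sigma> \<tau> = \<sigma>"
    and "map2 (interpolation (replicate (Suc n) 1)) \<sigma> \<tau> = \<tau>"
  using assms monotone_maps_nth[OF assms(1)] monotone_maps_nth[OF assms(2)]
  by (auto simp: interpolation_def monotone_maps_def less_Suc_eq_le simp del: replicate_Suc intro!: nth_equalityI)

text \<open>By naturality of \<open>\<rho>\<close>, the operator \<open>\<sigma>\<close> takes the
  diagonal simplex to \<open>\<rho> k (\<sigma>, \<sigma>)\<close>, which is the twist by the first
  projection.\<close>

lemma constant_section_diagonal_restriction:
  assumes "(a, \<rho>) \<in> simps (diag (section_complex X h)) n"
  shows "scomp (diag (section_complex X h)) (constant_section X h) (diagonal_restriction X h) n (a, \<rho>) =
    (a, twist n (interpolation (replicate (Suc n) 0)) \<rho>)"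
proof -
  have \<rho>: "\<rho> \<in> sections X h n a n" and a: "a \<in> simps real_line n"
    using assms by (auto simp: simps_diag_section_complex)
  \<comment> \<open>The composite recomputes the first component as the height of the diagonal
    simplex; this has to give \<open>a\<close> back.\<close>
  have "act real_line n [0..<Suc n] a = a"
    using simplicial_set_real_line a unfolding simplicial_set_def by blast
  then have "h n (\<rho> n ([0..<Suc n], [0..<Suc n])) = a"
    using sections_height[OF \<rho> monotone_maps_id monotone_maps_id] by simp
  moreover have "act X n \<sigma> (\<rho> n ([0..<Suc n], [0..<Suc n])) = \<rho> k (\<sigma>, \<sigma>)" if "\<sigma> \<in> monotone_maps k n" for \<sigma> k
    using sections_act[OF \<rho> monotone_maps_id monotone_maps_id that] by (simp add: map_id_op[OF that] del: upt_Suc)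
  ultimately show ?thesis
    using assms sections_in_simps[OF \<rho> monotone_maps_id monotone_maps_id]
    by (auto simp: scomp_def compose_def diagonal_restriction_def constant_section_def twist_def
        map2_const_interpolation fun_eq_iff simp del: upt_Suc replicate_Suc)
qed

lemma shomotopic_constant_section_diagonal_restriction:
  fixes X h defines "D \<equiv> diag (section_complex X h)"
  shows "shomotopic D D (scomp D (constant_section X h) (diagonal_restriction X h)) (sid D)"
proof -
  have v: "replicate (Suc n) e \<in> simps horn n" if "e = 0 \<or> e = 1" for n e
    using that by (auto simp: simps_horn monotone_maps_def)
  have H: "section_homotopy X h n ((a, \<rho>), replicate (Suc n) e) =
      (a, twist n (interpolation (replicate (Suc n) e)) \<rho>)"
    if "(a, \<rho>) \<in> simps D n" "e = 0 \<or> e = 1" for n a \<rho> e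
    using that v by (simp add: section_homotopy_def sprod_def D_def del: replicate_Suc)
  \<comment> \<open>Twisting by the second projection leaves the values on simplices alone;
    \<open>section_ext\<close> takes care of the default value elsewhere.\<close>
  have tw: "twist n (interpolation (replicate (Suc n) 1)) \<rho> = \<rho>" if "(a, \<rho>) \<in> simps D n" for n a \<rho>
  proof -
    have "\<rho> \<in> sections X h n a n" using that by (simp add: D_def simps_diag_section_complex)
    from section_ext[OF this] show ?thesis
      by (simp add: twist_def[abs_def] map2_const_interpolation cong: restrict_cong2 del: replicate_Suc One_nat_def)
  qed
  have "section_homotopy X h n (y, act horn 0 (replicate (Suc n) 0) [0]) =
         scomp D (constant_section X h) (diagonal_restriction X h) n y \<and>
       section_homotopy X h n (y, act horn 0 (replicate (Suc n) 0) [1]) = sid D n y"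
    if "y \<in> simps D n" for n y
    using that constant_section_diagonal_restriction[of "fst y" "snd y" X h n] H[of "fst y" "snd y" n]
      tw[of "fst y" "snd y" n]
    unfolding vertex_horn by (simp add: D_def sid_def del: replicate_Suc)
  then show ?thesis
    unfolding shomotopic_def
    using simplicial_interval_horn section_homotopy_simplicial[of X h] unfolding D_def by blast
qed

theorem theorem1p1:
  fixes X :: "'a sset" and h :: "nat \<Rightarrow> 'a \<Rightarrow> real list"
  assumes "simplicial_set X"
    and "h \<in> simplicial_maps X real_line"
  shows "diag (section_complex X h) \<simeq>\<^sub>s X"
  unfolding shomotopy_equivalent_def
  using diagonal_restriction_simplicial constant_section_simplicial[OF assms]
    shomotopic_constant_section_diagonal_restriction
    shomotopic_refl[OF sid_simplicial[OF assms(1)] assms(1)]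
  \<comment> \<open>The composite on \<open>X\<close> equals the identity, so the constant homotopy
    suffices there.\<close>
  by (metis diagonal_restriction_constant_section[OF assms])

end
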